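(* Let $I=\mathbb N_0\times\mathbb N$ and $X=c_0(I)$, with dual $X^*=\ell^1(I)$, let $A:X\rightrightarrows X^*$ be the operator with domain $\operatorname{dom}A=D$ given in the context, and let $$C=\{x\in X:x_{0,1}\ge-1\}.$$ Then $A$ and the normal cone operator $N_C$ are maximally monotone, $$\operatorname{dom}A\cap\operatorname{int}(\operatorname{dom}N_C)\neq\varnothing,$$ and $A+N_C$ is not maximally monotone. Thus the sum theorem under Rockafellar's constraint qualification fails in nonreflexive Banach spaces, i.e. there exist a nonreflexive real Banach space $X$ and maximally monotone operators $A,B:X\rightrightarrows X^*$ with $\operatorname{dom}A\cap\operatorname{int}(\operatorname{dom}B)\neq\varnothing$ such that $A+B$ is not maximally monotone.
   Context: Here $\mathbb N=\{1,2,3,\dots\}$, $\mathbb N_0=\mathbb N\cup\{0\}$, $I=\mathbb N_0\times\mathbb N$. All spaces are real. $X=c_0(I)$ is the space of real arrays $x=(x_{b,j})_{b\ge0,j\ge1}$ such that for every $\varepsilon>0$ only finitely many coordinates satisfy $|x_{b,j}|\ge\varepsilon$, with norm $\|x\|_\infty=\sup_{b,j}|x_{b,j}|$. Its dual is $X^*=\ell^1(I)$, with pairing $\langle x,p\rangle=\sum_{b\ge0}\sum_{j\ge1}x_{b,j}p_{b,j}$. Define (empty sums being $0$) $$D=\Bigl\{x\in X:\ |x_{0,1}|>1,\ \sum_{b=1}^{\infty}\sum_{j=1}^{\infty}\Bigl|4^b\Bigl(x_{b,j}+2\sum_{k=1}^{j-1}(-1)^{j-k}x_{b,k}\Bigr)+\frac{2(-1)^{j-1}}{|x_{0,1}|^b}\Bigr|<+\infty\Bigr\}.$$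 For $x\in D$, $Ax$ is the singleton (identified with its element of $\ell^1(I)$) with coordinates $$(Ax)_{0,1}=x_{0,1}-\operatorname{sgn}(x_{0,1}),\qquad (Ax)_{0,j}=0\ \ (j\ge2),$$ $$(Ax)_{b,j}=4^b\Bigl(x_{b,j}+2\sum_{k=1}^{j-1}(-1)^{j-k}x_{b,k}\Bigr)+\frac{2(-1)^{j-1}}{|x_{0,1}|^b}\quad(b\ge1,\ j\ge1).$$ For $x\notin D$, $Ax=\varnothing$. Thus $\operatorname{dom}A=D$. For a real Banach space $X$ and a set-valued operator $A:X\rightrightarrows X^*$, write $\operatorname{gra}A=\{(x,a):a\in Ax\}$ and $\operatorname{dom}A=\{x:Ax\neq\varnothing\}$. $A$ is monotone if $\langle x-y,a-c\rangle\ge0$ for all $(x,a),(y,c)\in\operatorname{gra}A$. A monotone operator $A$ is maximally monotone if every $(z,p)\in X\times X^*$ with $\langle z-x,p-a\rangle\ge0$ for all $(x,a)\in\operatorname{gra}A$ belongs to $\operatorname{gra}A$. The sum is $(A+B)x=\{a+b:a\in Ax,\ b\in Bx\}$, so $\operatorname{dom}(A+B)=\operatorname{dom}A\cap\operatorname{dom}B$. For a closed convex set $C\subseteq X$, the normal cone operator $N_C:X\rightrightarrows X^*$ is $N_C(x)=\{p\in X^*:\langle y-x,p\rangle\le0\text{ for all }y\in C\}$ for $x\in C$ and $N_C(x)=\varnothing$ for $x\notin C$. $\operatorname{int}$ denotes the norm interior. *)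

theory Defs
  imports "HOL-Analysis.Analysis"
begin

section \<open>Set-valued operators from a Banach space to its dual\<close>

type_synonym 'a setop = "'a \<Rightarrow> ('a \<Rightarrow>\<^sub>L real) set"

definition gra :: "'a::banach setop \<Rightarrow> ('a \<times> ('a \<Rightarrow>\<^sub>L real)) set" where
  "gra A = {(x, a). a \<in> A x}"

definition op_dom :: "'a::banach setop \<Rightarrow> 'a set" where
  "op_dom A = {x. A x \<noteq> {}}"

definition monotone_operator :: "'a::banach setop \<Rightarrow> bool" where
  "monotone_operator A \<longleftrightarrow>
     (\<forall>(x, a)\<in>gra A. \<forall>(y, c)\<in>gra A. 0 \<le> blinfun_apply (a - c) (x - y))"

definition maximally_monotone :: "'a::banach setop \<Rightarrow> bool" where
  "maximally_monotone A \<longleftrightarrow> monotone_operator A \<and>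
     (\<forall>z p. (\<forall>(x, a)\<in>gra A. 0 \<le> blinfun_apply (p - a) (z - x)) \<longrightarrow> (z, p) \<in> gra A)"

definition op_sum :: "'a::banach setop \<Rightarrow> 'a setop \<Rightarrow> 'a setop" where
  "op_sum A B = (\<lambda>x. {a + b |a b. a \<in> A x \<and> b \<in> B x})"

definition normal_cone :: "'a::banach set \<Rightarrow> 'a setop" where
  "normal_cone C = (\<lambda>x. if x \<in> C then {p. \<forall>y\<in>C. blinfun_apply p (y - x) \<le> 0} else {})"

definition bidual_embedding :: "'a::real_normed_vector \<Rightarrow> (('a \<Rightarrow>\<^sub>L real) \<Rightarrow>\<^sub>L real)" where
  "bidual_embedding x = Blinfun (\<lambda>p. blinfun_apply p x)"

lemma bidual_embedding_apply: "blinfun_apply (bidual_embedding x) p = blinfun_apply p x"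
  unfolding bidual_embedding_def
  by (simp add: bounded_linear_Blinfun_apply blinfun.bounded_linear_left)

definition reflexive_space :: "'a::banach itself \<Rightarrow> bool" where
  "reflexive_space _ \<longleftrightarrow> surj (bidual_embedding :: 'a \<Rightarrow> _)"


section \<open>The space of null arrays\<close>

definition idx :: "(nat \<times> nat) set" where
  "idx = UNIV \<times> {1..}"

text \<open>Arrays are total functions on pairs of naturals, set to zero outside the index set.\<close>

typedef c0 = "{x :: nat \<times> nat \<Rightarrow> real.
    (\<forall>i. i \<notin> idx \<longrightarrow> x i = 0) \<and> (\<forall>\<epsilon>>0. finite {i\<in>idx. \<epsilon> \<le> \<bar>x i\<bar>})}"
  morphisms coord Abs_c0
  by (rule exI[of _ "\<lambda>_. 0"]) auto

setup_lifting type_definition_c0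

lemma coord_outside: "i \<notin> idx \<Longrightarrow> coord x i = 0"
  using coord[of x] by blast

lemma coord_finite: "0 < \<epsilon> \<Longrightarrow> finite {i\<in>idx. \<epsilon> \<le> \<bar>coord x i\<bar>}"
  using coord[of x] by blast

lemma c0_eqI: "(\<And>i. i \<in> idx \<Longrightarrow> coord x i = coord y i) \<Longrightarrow> x = y"
  by (metis coord_inject coord_outside ext)

lemma one_idx: "(0, 1) \<in> idx"
  by (simp add: idx_def)

instantiation c0 :: real_normed_vector
begin

lift_definition zero_c0 :: c0 is "\<lambda>_. 0" by auto

lift_definition plus_c0 :: "c0 \<Rightarrow> c0 \<Rightarrow> c0" is "\<lambda>x y i. x i + y i"
proof (intro conjI allI impI)
  fix x y :: "nat \<times> nat \<Rightarrow> real" and \<epsilon> :: real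
  assume x: "(\<forall>i. i \<notin> idx \<longrightarrow> x i = 0) \<and> (\<forall>\<epsilon>>0. finite {i\<in>idx. \<epsilon> \<le> \<bar>x i\<bar>})"
    and y: "(\<forall>i. i \<notin> idx \<longrightarrow> y i = 0) \<and> (\<forall>\<epsilon>>0. finite {i\<in>idx. \<epsilon> \<le> \<bar>y i\<bar>})"
  show "x i + y i = 0" if "i \<notin> idx" for i using x y that by (metis add_0)
  assume "0 < \<epsilon>"
  then have "finite ({i\<in>idx. \<epsilon>/2 \<le> \<bar>x i\<bar>} \<union> {i\<in>idx. \<epsilon>/2 \<le> \<bar>y i\<bar>})"
    using x y half_gt_zero by blast
  moreover have "{i\<in>idx. \<epsilon> \<le> \<bar>x i + y i\<bar>} \<subseteq> {i\<in>idx. \<epsilon>/2 \<le> \<bar>x i\<bar>} \<union> {i\<in>idx. \<epsilon>/2 \<le> \<bar>y i\<bar>}"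
    by auto
  ultimately show "finite {i\<in>idx. \<epsilon> \<le> \<bar>x i + y i\<bar>}" by (rule finite_subset[rotated])
qed

lift_definition scaleR_c0 :: "real \<Rightarrow> c0 \<Rightarrow> c0" is "\<lambda>r x i. r * x i"
proof (intro conjI allI impI)
  fix x :: "nat \<times> nat \<Rightarrow> real" and r \<epsilon> :: real
  assume x: "(\<forall>i. i \<notin> idx \<longrightarrow> x i = 0) \<and> (\<forall>\<epsilon>>0. finite {i\<in>idx. \<epsilon> \<le> \<bar>x i\<bar>})"
  show "r * x i = 0" if "i \<notin> idx" for i using x that by (metis mult_zero_right)
  assume e: "0 < \<epsilon>"
  show "finite {i\<in>idx. \<epsilon> \<le> \<bar>r * x i\<bar>}"
  proof (cases "r = 0")
    case False
    have "{i\<in>idx. \<epsilon> \<le> \<bar>r * x i\<bar>} = {i\<in>idx. \<epsilon> / \<bar>r\<bar> \<le> \<bar>x i\<bar>}"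
      using False by (auto simp: field_simps abs_mult)
    then show ?thesis using x e False by simp
  qed (use e in simp)
qed

definition uminus_c0 :: "c0 \<Rightarrow> c0" where "uminus_c0 x = (- 1) *\<^sub>R x"

definition minus_c0 :: "c0 \<Rightarrow> c0 \<Rightarrow> c0" where "minus_c0 x y = x + (- y)"

definition norm_c0 :: "c0 \<Rightarrow> real" where "norm_c0 x = (SUP i\<in>idx. \<bar>coord x i\<bar>)"

definition dist_c0 :: "c0 \<Rightarrow> c0 \<Rightarrow> real" where "dist_c0 x y = norm (x - y)"

definition sgn_c0 :: "c0 \<Rightarrow> c0" where "sgn_c0 x = inverse (norm x) *\<^sub>R x"

definition uniformity_c0 :: "(c0 \<times> c0) filter" where
  "uniformity_c0 = (INF e\<in>{0<..}. principal {(x, y). dist x y < e})"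

definition open_c0 :: "c0 set \<Rightarrow> bool" where
  "open_c0 U = (\<forall>x\<in>U. \<forall>\<^sub>F (x', y) in uniformity. x' = x \<longrightarrow> y \<in> U)"

lemma coord_simps0:
  "coord 0 i = 0" "coord (x + y) i = coord x i + coord y i" "coord (r *\<^sub>R x) i = r * coord x i"
  by (transfer, simp)+

lemma coord_simps1:
  "coord (- x) i = - coord x i" "coord (x - y) i = coord x i - coord y i"
  by (simp_all add: uminus_c0_def minus_c0_def coord_simps0)

lemma coord_bdd: "bdd_above ((\<lambda>i. \<bar>coord x i\<bar>) ` idx)"
proof -
  let ?F = "{i\<in>idx. 1 \<le> \<bar>coord x i\<bar>}"
  have fin: "finite ?F" by (rule coord_finite) simp
  have "\<bar>coord x i\<bar> \<le> 1 + (\<Sum>i\<in>?F. \<bar>coord x i\<bar>)" if "i \<in> idx" for i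
  proof (cases "i \<in> ?F")
    case True
    then show ?thesis using member_le_sum[OF True _ fin, of "\<lambda>i. \<bar>coord x i\<bar>"] by simp
  next
    case False
    then have "\<bar>coord x i\<bar> \<le> 1" using that by auto
    moreover have "0 \<le> (\<Sum>i\<in>?F. \<bar>coord x i\<bar>)" by (intro sum_nonneg) simp
    ultimately show ?thesis by linarith
  qed
  then show ?thesis by (intro bdd_aboveI2)
qed

lemma coord_le_norm: "\<bar>coord x i\<bar> \<le> norm x"
proof (cases "i \<in> idx")
  case True
  then show ?thesis unfolding norm_c0_def by (intro cSUP_upper coord_bdd)
next
  case False
  have "0 \<le> \<bar>coord x (0,1)\<bar>" by simp
  also have "\<dots> \<le> norm x" unfolding norm_c0_def by (intro cSUP_upper coord_bdd one_idx)
  finally show ?thesis using coord_outside[OF False, of x] by simp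
qed

lemma norm_c0_leI: "(\<And>i. i \<in> idx \<Longrightarrow> \<bar>coord x i\<bar> \<le> c) \<Longrightarrow> norm x \<le> c"
  unfolding norm_c0_def using one_idx by (intro cSUP_least) auto

instance
proof
  fix x y z :: c0 and a b :: real
  show "x + y + z = x + (y + z)" "x + y = y + x" "0 + x = x" "- x + x = 0" "x - y = x + - y"
    by (rule c0_eqI; simp add: coord_simps0 coord_simps1)+
  show "a *\<^sub>R (x + y) = a *\<^sub>R x + a *\<^sub>R y" "(a + b) *\<^sub>R x = a *\<^sub>R x + b *\<^sub>R x"
    "a *\<^sub>R b *\<^sub>R x = (a * b) *\<^sub>R x" "1 *\<^sub>R x = x"
    by (rule c0_eqI; simp add: coord_simps0 algebra_simps)+
  show "dist x y = norm (x - y)" by (fact dist_c0_def)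
  show "sgn x = inverse (norm x) *\<^sub>R x" by (fact sgn_c0_def)
  show "uniformity = (INF e\<in>{0<..}. principal {(x, y :: c0). dist x y < e})"
    by (fact uniformity_c0_def)
  show "open U = (\<forall>x\<in>U. \<forall>\<^sub>F (x', y) in uniformity. x' = x \<longrightarrow> y \<in> U)" for U :: "c0 set"
    by (fact open_c0_def)
  show "norm x = 0 \<longleftrightarrow> x = 0"
  proof
    assume "norm x = 0"
    then have "coord x i = 0" for i using coord_le_norm[of x i] by simp
    then show "x = 0" by (intro c0_eqI) (simp add: coord_simps0)
  next
    assume "x = 0"
    then have "norm x \<le> 0" by (intro norm_c0_leI) (simp add: coord_simps0)
    moreover have "0 \<le> norm x" using coord_le_norm[of x "(0,1)"] by linarith
    ultimately show "norm x = 0" by simp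
  qed
  show "norm (x + y) \<le> norm x + norm y"
  proof (rule norm_c0_leI)
    fix i
    show "\<bar>coord (x + y) i\<bar> \<le> norm x + norm y"
      using coord_le_norm[of x i] coord_le_norm[of y i] by (simp add: coord_simps0)
  qed
  have le: "norm (a *\<^sub>R x) \<le> \<bar>a\<bar> * norm x" for a and x :: c0
    by (rule norm_c0_leI) (simp add: coord_simps0 abs_mult coord_le_norm mult_left_mono)
  show "norm (a *\<^sub>R x) = \<bar>a\<bar> * norm x"
  proof (cases "a = 0")
    case True
    then show ?thesis using le[of a x] coord_le_norm[of "a *\<^sub>R x" "(0,1)"] by simp
  next
    case False
    have "inverse a *\<^sub>R a *\<^sub>R x = x"
      by (rule c0_eqI) (simp add: coord_simps0 False)
    then have "norm x \<le> \<bar>inverse a\<bar> * norm (a *\<^sub>R x)"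
      using le[of "inverse a" "a *\<^sub>R x"] by simp
    then have "\<bar>a\<bar> * norm x \<le> norm (a *\<^sub>R x)" using False by (simp add: field_simps)
    then show ?thesis using le[of a x] by simp
  qed
qed

end

lemmas coord_simps [simp] = coord_simps0 coord_simps1

lemma coord_sum [simp]: "coord (sum f F) i = (\<Sum>k\<in>F. coord (f k) i)"
  by (induction F rule: infinite_finite_induct) auto

lemma bounded_linear_coord: "bounded_linear (\<lambda>x. coord x i)"
  by (rule bounded_linear_intro[where K = 1]) (simp_all add: coord_le_norm)

instance c0 :: banach
proof
  fix X :: "nat \<Rightarrow> c0"
  assume X: "Cauchy X"
  define l where "l i = lim (\<lambda>n. coord (X n) i)" for i
  have lim: "(\<lambda>n. coord (X n) i) \<longlonglongrightarrow> l i" for i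
  proof -
    have "Cauchy (\<lambda>n. coord (X n) i)"
      by (rule bounded_linear.Cauchy[OF bounded_linear_coord X])
    then show ?thesis unfolding l_def by (simp add: Cauchy_convergent_iff convergent_LIMSEQ_iff)
  qed
  have unif: "\<exists>N. \<forall>n\<ge>N. \<forall>i. \<bar>coord (X n) i - l i\<bar> \<le> e" if e: "0 < e" for e
  proof -
    obtain N where N: "\<And>m n. N \<le> m \<Longrightarrow> N \<le> n \<Longrightarrow> norm (X m - X n) < e"
      using CauchyD[OF X e] by blast
    have "\<bar>coord (X n) i - l i\<bar> \<le> e" if n: "N \<le> n" for n i
    proof (rule LIMSEQ_le_const2)
      show "(\<lambda>m. \<bar>coord (X n) i - coord (X m) i\<bar>) \<longlonglongrightarrow> \<bar>coord (X n) i - l i\<bar>"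
        by (intro tendsto_intros lim)
      have "\<bar>coord (X n) i - coord (X m) i\<bar> \<le> e" if "N \<le> m" for m
        using coord_le_norm[of "X n - X m" i] N[OF n that] by simp
      then show "\<exists>N. \<forall>m\<ge>N. \<bar>coord (X n) i - coord (X m) i\<bar> \<le> e" by blast
    qed
    then show ?thesis by blast
  qed
  have out: "l i = 0" if "i \<notin> idx" for i
    using lim[of i] coord_outside[OF that] by (simp add: LIMSEQ_const_iff)
  have fin: "finite {i\<in>idx. e \<le> \<bar>l i\<bar>}" if e: "0 < e" for e
  proof -
    obtain N where N: "\<And>i. \<bar>coord (X N) i - l i\<bar> \<le> e/2"
      using unif[of "e/2"] half_gt_zero[OF e] by blast
    have "e/2 \<le> \<bar>coord (X N) i\<bar>" if "e \<le> \<bar>l i\<bar>" for i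
      using N[of i] that by linarith
    then have "{i\<in>idx. e \<le> \<bar>l i\<bar>} \<subseteq> {i\<in>idx. e/2 \<le> \<bar>coord (X N) i\<bar>}" by auto
    then show ?thesis by (rule finite_subset) (rule coord_finite[OF half_gt_zero[OF e]])
  qed
  define L where "L = Abs_c0 l"
  have L: "coord L i = l i" for i
    unfolding L_def by (subst Abs_c0_inverse) (use out fin in auto)
  have "X \<longlonglongrightarrow> L"
  proof (rule LIMSEQ_I)
    fix r :: real
    assume "0 < r"
    then obtain N where N: "\<And>n i. N \<le> n \<Longrightarrow> \<bar>coord (X n) i - l i\<bar> \<le> r/2"
      using unif[of "r/2"] half_gt_zero by blast
    have "norm (X n - L) \<le> r/2" if "N \<le> n" for n
      by (rule norm_c0_leI) (use N that L in simp)
    then show "\<exists>N. \<forall>n\<ge>N. norm (X n - L) < r" using \<open>0 < r\<close>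
      by (intro exI[of _ N]) fastforce
  qed
  then show "convergent X" by (rule convergentI)
qed


section \<open>Summable arrays as functionals\<close>

text \<open>Only meaningful for arrays absolutely summable on \<open>idx\<close>; values off \<open>idx\<close> are ignored.\<close>

definition l1_functional :: "(nat \<times> nat \<Rightarrow> real) \<Rightarrow> (c0 \<Rightarrow>\<^sub>L real)" where
  "l1_functional a = Blinfun (\<lambda>x. \<Sum>\<^sub>\<infinity>i\<in>idx. coord x i * a i)"

lemma l1_pairing_summable:
  assumes "(\<lambda>i. norm (a i)) summable_on idx"
  shows "(\<lambda>i. norm (coord x i * a i)) summable_on idx"
proof (rule Infinite_Sum.abs_summable_on_comparison_test')
  show "(\<lambda>i. norm x * norm (a i)) summable_on idx"
    using assms by (rule summable_on_cmult_right)
  show "norm (coord x i * a i) \<le> norm x * norm (a i)" for i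
    by (simp add: abs_mult coord_le_norm mult_right_mono)
qed

lemma l1_functional_apply:
  assumes a: "(\<lambda>i. norm (a i)) summable_on idx"
  shows "blinfun_apply (l1_functional a) x = (\<Sum>\<^sub>\<infinity>i\<in>idx. coord x i * a i)"
proof -
  note s = abs_summable_summable[OF l1_pairing_summable[OF a]]
  have "bounded_linear (\<lambda>x. \<Sum>\<^sub>\<infinity>i\<in>idx. coord x i * a i)"
  proof (rule bounded_linear_intro[where K = "\<Sum>\<^sub>\<infinity>i\<in>idx. \<bar>a i\<bar>"])
    fix x y :: c0 and r :: real
    show "(\<Sum>\<^sub>\<infinity>i\<in>idx. coord (x + y) i * a i) =
        (\<Sum>\<^sub>\<infinity>i\<in>idx. coord x i * a i) + (\<Sum>\<^sub>\<infinity>i\<in>idx. coord y i * a i)"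
      unfolding coord_simps distrib_right by (rule infsum_add[OF s s])
    show "(\<Sum>\<^sub>\<infinity>i\<in>idx. coord (r *\<^sub>R x) i * a i) = r *\<^sub>R (\<Sum>\<^sub>\<infinity>i\<in>idx. coord x i * a i)"
      by (simp add: mult.assoc infsum_cmult_right')
    have "norm (\<Sum>\<^sub>\<infinity>i\<in>idx. coord x i * a i) \<le> (\<Sum>\<^sub>\<infinity>i\<in>idx. norm (coord x i * a i))"
      by (rule norm_infsum_bound[OF l1_pairing_summable[OF a]])
    also have "\<dots> \<le> (\<Sum>\<^sub>\<infinity>i\<in>idx. norm x * \<bar>a i\<bar>)"
    proof (rule infsum_mono)
      show "(\<lambda>i. norm (coord x i * a i)) summable_on idx" by (rule l1_pairing_summable[OF a])
      show "(\<lambda>i. norm x * \<bar>a i\<bar>) summable_on idx"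
        using summable_on_cmult_right[OF a, of "norm x"] by simp
      show "norm (coord x i * a i) \<le> norm x * \<bar>a i\<bar>" for i
        by (simp add: abs_mult coord_le_norm mult_right_mono)
    qed
    finally show "norm (\<Sum>\<^sub>\<infinity>i\<in>idx. coord x i * a i) \<le> norm x * (\<Sum>\<^sub>\<infinity>i\<in>idx. \<bar>a i\<bar>)"
      by (simp add: infsum_cmult_right')
  qed
  then show ?thesis unfolding l1_functional_def by (simp add: bounded_linear_Blinfun_apply)
qed

lift_definition unit_array :: "nat \<times> nat \<Rightarrow> c0" is "\<lambda>i k. if k = i \<and> k \<in> idx then 1 else 0"
proof (intro conjI allI impI)
  fix i :: "nat \<times> nat" and \<epsilon> :: real
  assume "0 < \<epsilon>"
  then have "{k\<in>idx. \<epsilon> \<le> \<bar>if k = i \<and> k \<in> idx then 1 else 0\<bar>} \<subseteq> {i}"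
    by (auto split: if_splits)
  then show "finite {k\<in>idx. \<epsilon> \<le> \<bar>if k = i \<and> k \<in> idx then 1 else 0\<bar>}"
    by (rule finite_subset) simp
qed auto

lemma coord_unit_array: "i \<in> idx \<Longrightarrow> coord (unit_array i) k = (if k = i then 1 else 0)"
  by (transfer; auto)

lemma coord_unit_combination:
  assumes "finite F" "F \<subseteq> idx"
  shows "coord (\<Sum>i\<in>F. c i *\<^sub>R unit_array i) k = (if k \<in> F then c k else 0)"
proof -
  have "coord (\<Sum>i\<in>F. c i *\<^sub>R unit_array i) k = (\<Sum>i\<in>F. if k = i then c i else 0)"
    unfolding coord_sum using assms by (intro sum.cong) (auto simp: coord_unit_array)
  then show ?thesis using assms by simp
qed

lemma unit_array_has_sum: "((\<lambda>i. coord x i *\<^sub>R unit_array i) has_sum x) idx"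
  unfolding has_sum_def tendsto_iff eventually_finite_subsets_at_top
proof (intro allI impI)
  fix e :: real
  assume e: "0 < e"
  let ?F = "{i\<in>idx. e/2 \<le> \<bar>coord x i\<bar>}"
  have fin: "finite ?F" using e by (intro coord_finite) simp
  have "dist (\<Sum>i\<in>G. coord x i *\<^sub>R unit_array i) x < e"
    if G: "finite G" "?F \<subseteq> G" "G \<subseteq> idx" for G
  proof -
    have "norm ((\<Sum>i\<in>G. coord x i *\<^sub>R unit_array i) - x) \<le> e/2"
    proof (rule norm_c0_leI)
      fix i assume "i \<in> idx"
      then show "\<bar>coord ((\<Sum>i\<in>G. coord x i *\<^sub>R unit_array i) - x) i\<bar> \<le> e/2"
        unfolding coord_simps coord_unit_combination[OF G(1,3)] using G(2) e by auto
    qed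
    then show ?thesis using e by (simp add: dist_norm)
  qed
  then show "\<exists>X. finite X \<and> X \<subseteq> idx \<and> (\<forall>Y. finite Y \<and> X \<subseteq> Y \<and> Y \<subseteq> idx \<longrightarrow>
      dist (\<Sum>i\<in>Y. coord x i *\<^sub>R unit_array i) x < e)"
    using fin by (intro exI[of _ ?F]) auto
qed

lemma functional_coeffs_bound:
  fixes p :: "c0 \<Rightarrow>\<^sub>L real"
  assumes F: "finite F" "F \<subseteq> idx"
  shows "(\<Sum>i\<in>F. \<bar>blinfun_apply p (unit_array i)\<bar>) \<le> norm p"
proof -
  let ?a = "\<lambda>i. blinfun_apply p (unit_array i)"
  let ?s = "\<Sum>i\<in>F. sgn (?a i) *\<^sub>R unit_array i"
  have "norm ?s \<le> 1"
    by (rule norm_c0_leI) (simp only: coord_unit_combination[OF F], simp add: abs_sgn_eq)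
  have "(\<Sum>i\<in>F. \<bar>?a i\<bar>) = blinfun_apply p ?s"
    by (simp add: blinfun.sum_right blinfun.scaleR_right abs_sgn mult.commute)
  also have "\<dots> \<le> norm p * norm ?s" using norm_blinfun[of p ?s] by simp
  also have "\<dots> \<le> norm p" using \<open>norm ?s \<le> 1\<close> mult_left_mono[of "norm ?s" 1 "norm p"] by simp
  finally show ?thesis .
qed

text \<open>
  The next three facts say that \<open>l1_functional\<close> is an isometric bijection from the absolutely
  summable arrays on \<open>idx\<close> onto the dual space.
\<close>

lemma l1_functional_surj:
  fixes p :: "c0 \<Rightarrow>\<^sub>L real"
  obtains a where "(\<lambda>i. norm (a i)) summable_on idx" "p = l1_functional a"
proof
  let ?a = "\<lambda>i. blinfun_apply p (unit_array i)"
  show a: "(\<lambda>i. norm (?a i)) summable_on idx"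
    by (rule nonneg_bdd_above_summable_on)
      (auto intro!: bdd_aboveI[where M = "norm p"] simp: functional_coeffs_bound)
  show "p = l1_functional ?a"
  proof (rule blinfun_eqI)
    fix x
    have "((\<lambda>i. blinfun_apply p (coord x i *\<^sub>R unit_array i)) has_sum blinfun_apply p x) idx"
      by (rule has_sum_bounded_linear[OF blinfun.bounded_linear_right unit_array_has_sum])
    then have "((\<lambda>i. coord x i * ?a i) has_sum blinfun_apply p x) idx"
      by (simp add: blinfun.scaleR_right)
    then show "blinfun_apply p x = blinfun_apply (l1_functional ?a) x"
      by (simp add: l1_functional_apply[OF a] infsumI)
  qed
qed

lemma l1_functional_unit_array:
  assumes a: "(\<lambda>i. norm (a i)) summable_on idx" and i: "i \<in> idx"
  shows "blinfun_apply (l1_functional a) (unit_array i) = a i"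
proof -
  have "blinfun_apply (l1_functional a) (unit_array i)
      = (\<Sum>\<^sub>\<infinity>k\<in>idx. (if k = i then 1 else 0) * a k)"
    by (simp add: l1_functional_apply[OF a] coord_unit_array[OF i])
  also have "\<dots> = (\<Sum>\<^sub>\<infinity>k\<in>{i}. a k)"
    by (rule infsum_cong_neutral) (use i in auto)
  finally show ?thesis by simp
qed

lemma l1_functional_inj:
  assumes "(\<lambda>i. norm (a i)) summable_on idx" "(\<lambda>i. norm (b i)) summable_on idx" "l1_functional a = l1_functional b"
    and "i \<in> idx"
  shows "a i = b i"
  using assms l1_functional_unit_array by metis

lemma norm_l1_functional:
  assumes a: "(\<lambda>i. norm (a i)) summable_on idx"
  shows "norm (l1_functional a) = (\<Sum>\<^sub>\<infinity>i\<in>idx. \<bar>a i\<bar>)"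
proof (rule antisym)
  show "norm (l1_functional a) \<le> (\<Sum>\<^sub>\<infinity>i\<in>idx. \<bar>a i\<bar>)"
  proof (rule norm_blinfun_bound)
    show "0 \<le> (\<Sum>\<^sub>\<infinity>i\<in>idx. \<bar>a i\<bar>)" by (rule infsum_nonneg) simp
    fix x
    have "norm (\<Sum>\<^sub>\<infinity>i\<in>idx. coord x i * a i) \<le> (\<Sum>\<^sub>\<infinity>i\<in>idx. norm (coord x i * a i))"
      by (rule norm_infsum_bound[OF l1_pairing_summable[OF a]])
    also have "\<dots> \<le> (\<Sum>\<^sub>\<infinity>i\<in>idx. \<bar>a i\<bar> * norm x)"
    proof (rule infsum_mono)
      show "(\<lambda>i. norm (coord x i * a i)) summable_on idx" by (rule l1_pairing_summable[OF a])
      show "(\<lambda>i. \<bar>a i\<bar> * norm x) summable_on idx"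
        using summable_on_cmult_left[OF a, of "norm x"] by simp
      show "norm (coord x i * a i) \<le> \<bar>a i\<bar> * norm x" for i
        using mult_right_mono[OF coord_le_norm[of x i], of "\<bar>a i\<bar>"]
        by (simp add: abs_mult mult.commute)
    qed
    finally show "norm (blinfun_apply (l1_functional a) x) \<le> (\<Sum>\<^sub>\<infinity>i\<in>idx. \<bar>a i\<bar>) * norm x"
      by (simp add: l1_functional_apply[OF a] infsum_cmult_left')
  qed
  show "(\<Sum>\<^sub>\<infinity>i\<in>idx. \<bar>a i\<bar>) \<le> norm (l1_functional a)"
  proof (rule infsum_le_finite_sums)
    show "(\<lambda>i. \<bar>a i\<bar>) summable_on idx" using a by simp
    fix F assume F: "finite F" "F \<subseteq> idx"
    have "(\<Sum>i\<in>F. \<bar>a i\<bar>) = (\<Sum>i\<in>F. \<bar>blinfun_apply (l1_functional a) (unit_array i)\<bar>)"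
      by (rule sum.cong) (use F l1_functional_unit_array[OF a] in auto)
    also have "\<dots> \<le> norm (l1_functional a)" by (rule functional_coeffs_bound[OF F])
    finally show "(\<Sum>i\<in>F. \<bar>a i\<bar>) \<le> norm (l1_functional a)" .
  qed
qed


section \<open>The operator and the half-space\<close>

definition A_block :: "c0 \<Rightarrow> nat \<Rightarrow> nat \<Rightarrow> real" where
  "A_block x b j =
     4 ^ b * (coord x (b, j) + 2 * (\<Sum>k = 1..j - 1. (- 1) ^ (j - k) * coord x (b, k)))
     + 2 * (- 1) ^ (j - 1) / \<bar>coord x (0, 1)\<bar> ^ b"

definition A_coords :: "c0 \<Rightarrow> nat \<times> nat \<Rightarrow> real" where
  "A_coords x = (\<lambda>(b, j).
     if b = 0 then (if j = 1 then coord x (0, 1) - sgn (coord x (0, 1)) else 0)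
     else A_block x b j)"

text \<open>
  The iterated series is taken in \<open>ennreal\<close>, where it always has a value; its finiteness makes
  \<open>A_coords x\<close> absolutely summable (\<open>A_coords_summable\<close> below).
\<close>

definition D :: "c0 set" where
  "D = {x. 1 < \<bar>coord x (0, 1)\<bar> \<and>
           (\<Sum>\<^sub>\<infinity>b\<in>{1..}. \<Sum>\<^sub>\<infinity>j\<in>{1..}. ennreal \<bar>A_block x b j\<bar>) < \<infinity>}"

definition A_op :: "c0 setop" where
  "A_op x = (if x \<in> D then {l1_functional (A_coords x)} else {})"

lemma A_coords_summable:
  assumes x: "x \<in> D"
  shows "(\<lambda>i. norm (A_coords x i)) summable_on idx"
proof -
  define S where "S = (\<Sum>\<^sub>\<infinity>b\<in>{1..}. \<Sum>\<^sub>\<infinity>j\<in>{1..}. ennreal \<bar>A_block x b j\<bar>)"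
  have S: "S < \<infinity>" using x by (simp add: D_def S_def)
  have le: "sum f G \<le> infsum f B" if "finite G" "G \<subseteq> B" for f :: "nat \<Rightarrow> ennreal" and G B
  proof -
    have "infsum f G \<le> infsum f B"
      by (rule infsum_mono_neutral) (use that in \<open>auto intro: nonneg_summable_on_complete\<close>)
    then show ?thesis using that by simp
  qed
  let ?I = "{1..} \<times> {1..} :: (nat \<times> nat) set"
  have "(\<Sum>i\<in>F. norm (A_coords x i)) \<le> enn2real S" if F: "finite F" "F \<subseteq> ?I" for F
  proof -
    have "F \<subseteq> fst ` F \<times> snd ` F" by force
    have "(\<Sum>i\<in>F. norm (A_coords x i)) \<le> (\<Sum>i\<in>fst ` F \<times> snd ` F. norm (A_coords x i))"
      by (rule sum_mono2) (use F \<open>F \<subseteq> fst ` F \<times> snd ` F\<close> in auto)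
    also have "\<dots> = (\<Sum>b\<in>fst ` F. \<Sum>j\<in>snd ` F. norm (A_coords x (b, j)))"
      by (simp add: sum.cartesian_product)
    also have "\<dots> = (\<Sum>b\<in>fst ` F. \<Sum>j\<in>snd ` F. \<bar>A_block x b j\<bar>)"
      by (intro sum.cong refl) (use F in \<open>fastforce simp: A_coords_def\<close>)
    finally have "ennreal (\<Sum>i\<in>F. norm (A_coords x i)) \<le>
        ennreal (\<Sum>b\<in>fst ` F. \<Sum>j\<in>snd ` F. \<bar>A_block x b j\<bar>)"
      by (rule ennreal_leI)
    also have "\<dots> = (\<Sum>b\<in>fst ` F. \<Sum>j\<in>snd ` F. ennreal \<bar>A_block x b j\<bar>)"
      by (simp add: sum_nonneg)
    also have "\<dots> \<le> (\<Sum>b\<in>fst ` F. \<Sum>\<^sub>\<infinity>j\<in>{1..}. ennreal \<bar>A_block x b j\<bar>)"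
      by (rule sum_mono, rule le) (use F in auto)
    also have "\<dots> \<le> S"
      unfolding S_def by (rule le) (use F in auto)
    finally have "ennreal (\<Sum>i\<in>F. norm (A_coords x i)) \<le> S" .
    then have "enn2real (ennreal (\<Sum>i\<in>F. norm (A_coords x i))) \<le> enn2real S"
      by (rule enn2real_mono) (use S in simp)
    then show ?thesis by (simp add: sum_nonneg del: sum_ennreal)
  qed
  then have "(\<lambda>i. norm (A_coords x i)) summable_on ?I"
    by (intro nonneg_bdd_above_summable_on bdd_aboveI[where M = "enn2real S"]) auto
  moreover have "(\<lambda>i. norm (A_coords x i)) summable_on {(0, 1)}" by simp
  ultimately have "(\<lambda>i. norm (A_coords x i)) summable_on ({(0, 1)} \<union> ?I)"
    by (intro summable_on_Un_disjoint) auto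
  then show ?thesis
    by (rule summable_on_cong_neutral[THEN iffD1, rotated -1]) (auto simp: idx_def A_coords_def split: if_splits)
qed

lemma op_dom_A_op: "op_dom A_op = D"
  by (auto simp: op_dom_def A_op_def)

definition C_half :: "c0 set" where
  "C_half = {x. - 1 \<le> coord x (0, 1)}"

end

theory Submission
  imports Defs
begin

text \<open>
  For a summable sequence \<open>f\<close> with tails \<open>R n = f n + f (n + 1) + \<dots>\<close>, the Gossez operator sends \<open>f\<close>
  to \<open>n \<mapsto> R n + R (n + 1)\<close>. As \<open>f n = R n - R (n + 1)\<close>, pairing \<open>f\<close> with its image telescopes to
  \<open>(R 0)\<^sup>2\<close>, the square of the total sum. On each block \<open>b \<ge> 1\<close> the formula for \<open>A x\<close> inverts this
  operator: writing \<open>t\<close> for \<open>\<bar>x (0, 1)\<bar>\<close>, the pair \<open>(x, a)\<close> is in the graph exactly if \<open>t > 1\<close>, block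
  \<open>0\<close> of \<open>a\<close> is \<open>x (0, 1) - sgn (x (0, 1))\<close> followed by zeros, and for \<open>b \<ge> 1\<close> the block of \<open>a\<close> has
  sum \<open>1 / t ^ b\<close> while that of \<open>x\<close> is \<open>- 4 ^ - b\<close> times its image under the Gossez operator
  (\<open>A_op_iff\<close>, which rests on \<open>tail_of_skew\<close> and \<open>skew_of_tail\<close>).

  Consequently the pairing of the differences of two graph points is a scalar term minus
  \<open>\<Sum>b\<ge>1. (1 / s ^ b - 1 / t ^ b)\<^sup>2 / 4 ^ b\<close> (\<open>pairing_linked\<close>). The scalar term is at least
  \<open>(s - t)\<^sup>2\<close>, and \<open>\<bar>1 / s ^ b - 1 / t ^ b\<bar> \<le> b \<bar>s - t\<bar>\<close> with \<open>\<Sum>b\<ge>1. b\<^sup>2 / 4 ^ b = 20/27\<close> gives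
  monotonicity.

  For maximality, perturb \<open>a\<close> inside its blocks without changing their sums. The quadratic term does
  not move, so a pair \<open>(z, p)\<close> monotonically related to the graph satisfies linear equations, which
  say that \<open>z\<close> is linked to \<open>p\<close> by the Gossez operator as on the graph (\<open>related_imp_linked\<close>). What
  remains is a scalar inequality in \<open>z (0, 1)\<close>, \<open>p (0, 1)\<close> and the block sums of \<open>p\<close>. If
  \<open>\<bar>z (0, 1)\<bar> > 1\<close> it puts \<open>(z, p)\<close> into the graph. If \<open>\<bar>z (0, 1)\<bar> \<le> 1\<close>, the branches
  \<open>x (0, 1) > 1\<close> and \<open>x (0, 1) < - 1\<close> together lead to a contradiction, because the block sums of a
  summable \<open>p\<close> cannot all be \<open>1\<close> (\<open>not_related_small\<close>).

  Adding the normal cone of the half-space deletes the branch \<open>x (0, 1) < - 1\<close> and leaves the other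
  one unchanged. The contradiction disappears, and the pair of \<open>0\<close> and minus the distinguished
  coordinate functional is related to the sum without belonging to it
  (\<open>not_maximally_monotone_sum\<close>).
\<close>

section \<open>The Gossez operator on a single sequence\<close>

definition tail :: "(nat \<Rightarrow> real) \<Rightarrow> nat \<Rightarrow> real" where
  "tail f n = suminf f - sum f {..<n}"

lemma tail_0: "tail f 0 = suminf f"
  by (simp add: tail_def)

lemma tail_diff: "tail f n - tail f (Suc n) = f n"
  by (simp add: tail_def)

lemma tail_Suc: "tail f (Suc n) = tail f n - f n"
  by (simp add: tail_def)

lemma tail_tendsto_0: "summable f \<Longrightarrow> tail f \<longlonglongrightarrow> 0"
  unfolding tail_def
  using tendsto_diff[OF tendsto_const[of "suminf f"] summable_LIMSEQ[of f]] by simp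

lemma tail_add_scale:
  assumes "summable f" "summable g"
  shows "tail (\<lambda>k. f k + r * g k) n = tail f n + r * tail g n"
  using assms suminf_add[OF assms(1) summable_mult[OF assms(2), of r]]
  by (simp add: tail_def suminf_mult sum.distrib sum_distrib_left algebra_simps)

text \<open>
  Since \<open>f\<close> is the difference of consecutive tails and \<open>u\<close> is a multiple of their sum, every
  term of the pairing is a difference of squares of tails, and the series telescopes. Thus the
  quadratic form of the Gossez operator sees only the total sum of \<open>f\<close>.
\<close>

lemma quadratic_form_sums:
  assumes "summable f" and "\<And>n. c * u n = - (tail f n + tail f (Suc n))" and "c \<noteq> 0"
  shows "(\<lambda>n. u n * f n) sums (- (suminf f)\<^sup>2 / c)"
proof -
  have "(\<lambda>n. (tail f n)\<^sup>2 - (tail f (Suc n))\<^sup>2) sums ((tail f 0)\<^sup>2 - 0\<^sup>2)"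
    by (intro telescope_sums' tendsto_power tail_tendsto_0 assms(1))
  then have "(\<lambda>n. - (1 / c) * ((tail f n)\<^sup>2 - (tail f (Suc n))\<^sup>2)) sums (- (1 / c) * ((tail f 0)\<^sup>2 - 0\<^sup>2))"
    by (rule sums_mult)
  moreover have "- (1 / c) * ((tail f n)\<^sup>2 - (tail f (Suc n))\<^sup>2) = u n * f n" for n
  proof -
    have "c * (u n * f n) = c * u n * f n" by simp
    also have "\<dots> = - (tail f n + tail f (Suc n)) * (tail f n - tail f (Suc n))"
      by (simp add: assms(2) tail_diff)
    finally have "c * (u n * f n) = - ((tail f n)\<^sup>2 - (tail f (Suc n))\<^sup>2)"
      by (simp add: power2_eq_square algebra_simps)
    then show ?thesis using assms(3) by (simp add: field_simps)
  qed
  ultimately show ?thesis by (simp add: tail_0)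
qed

text \<open>
  The lower triangular matrix through which the blocks of \<open>A\<close> are written. The combination
  \<open>skew u (n + 1) + skew u n\<close> equals \<open>u (n + 1) - u n\<close>, which is what makes induction on \<open>n\<close> work.
\<close>

definition skew :: "(nat \<Rightarrow> real) \<Rightarrow> nat \<Rightarrow> real" where
  "skew u n = u n + 2 * (\<Sum>k<n. (- 1) ^ (n - k) * u k)"

lemma skew_0: "skew u 0 = u 0"
  by (simp add: skew_def)

lemma skew_Suc: "skew u (Suc n) = u (Suc n) - u n - skew u n"
proof -
  have "(\<Sum>k<n. (- 1) ^ (Suc n - k) * u k) = - (\<Sum>k<n. (- 1) ^ (n - k) * u k)"
    by (simp add: sum_negf[symmetric] Suc_diff_le)
  then show ?thesis by (simp add: skew_def)
qed

text \<open>
  The Gossez operator is a right inverse of \<open>- skew\<close>, up to an alternating sequence of size twice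
  the total sum.
\<close>

lemma skew_of_tail:
  assumes "\<And>n. c * u n = - (tail f n + tail f (Suc n))"
  shows "c * skew u n + 2 * (- 1) ^ n * suminf f = f n"
proof (induction n)
  case 0
  then show ?case using assms[of 0] tail_diff[of f 0] by (simp add: skew_0 tail_0)
next
  case (Suc n)
  have "c * skew u (Suc n) = c * u (Suc n) - c * u n - c * skew u n"
    by (simp add: skew_Suc algebra_simps)
  also have "\<dots> = tail f n - tail f (Suc (Suc n)) - c * skew u n"
    by (simp add: assms)
  also have "\<dots> = f n + f (Suc n) - c * skew u n"
    by (simp add: tail_Suc)
  finally show ?case using Suc by simp
qed

lemma skew_eq_alternating:
  assumes "\<And>n. skew w n = (- 1) ^ n * K"
  shows "w n = K"
proof (induction n)
  case 0
  then show ?case using assms[of 0] by (simp add: skew_0)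
next
  case (Suc n)
  then show ?case using assms[of n] assms[of "Suc n"] by (simp add: skew_Suc)
qed

lemma skew_add_scale: "skew (\<lambda>k. u k + r * v k) n = skew u n + r * skew v n"
  by (simp add: skew_def sum.distrib sum_distrib_left algebra_simps)

text \<open>
  Two sequences with the same image under \<open>c * skew\<close> up to an alternating sequence differ by a
  constant, by \<open>skew_eq_alternating\<close>. As both \<open>u\<close> and the tails of \<open>f\<close> tend to zero, that
  constant is zero; this is where it matters that \<open>x\<close> is a null array, and it is what
  fixes the sum of \<open>f\<close>.
\<close>

lemma tail_of_skew:
  assumes f: "summable f" and u: "u \<longlonglongrightarrow> 0" and c: "c \<noteq> 0"
    and eq: "\<And>n. c * skew u n + 2 * (- 1) ^ n * s = f n"
  shows "suminf f = s" and "c * u n = - (tail f n + tail f (Suc n))"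
proof -
  define v where "v n = - (1 / c) * (tail f n + tail f (Suc n))" for n
  define K where "K = 2 * (suminf f - s) / c"
  have v: "c * skew v n + 2 * (- 1) ^ n * suminf f = f n" for n
    by (rule skew_of_tail) (use c in \<open>simp add: v_def\<close>)
  have w: "u n + (- 1) * v n = K" for n
  proof (rule skew_eq_alternating)
    show "skew (\<lambda>n. u n + (- 1) * v n) n = (- 1) ^ n * K" for n
      unfolding skew_add_scale using v[of n] eq[of n] c
      by (simp add: K_def field_simps)
  qed
  have "(\<lambda>n. u n + (- 1) * v n) \<longlonglongrightarrow> 0 + (- 1) * (- (1 / c) * (0 + 0))"
    unfolding v_def by (intro tendsto_intros u tail_tendsto_0 f LIMSEQ_Suc)
  then have "K = 0" unfolding w by (simp add: LIMSEQ_const_iff)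
  then show "suminf f = s" using c by (simp add: K_def)
  show "c * u n = - (tail f n + tail f (Suc n))"
    using w[of n] \<open>K = 0\<close> c by (simp add: v_def field_simps)
qed

section \<open>Two estimates for the powers of the distinguished coordinate\<close>

lemma sum_square_over_4_power: "(\<Sum>b<n. (real (Suc b))\<^sup>2 / 4 ^ Suc b) \<le> 1"
proof -
  \<comment> \<open>The quadratic \<open>q\<close> solves \<open>q (n - 1) / 4 ^ (n - 1) - q n / 4 ^ n = n\<^sup>2 / 4 ^ n\<close>.\<close>
  have "(\<Sum>b<n. (real (Suc b))\<^sup>2 / 4 ^ Suc b)
      = 20/27 - ((real n)\<^sup>2 / 3 + 8 * real n / 9 + 20/27) / 4 ^ n"
  proof (induction n)
    case (Suc n)
    have "(real (Suc n))\<^sup>2 / 4 ^ Suc n = ((real n)\<^sup>2 / 3 + 8 * real n / 9 + 20/27) / 4 ^ n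
        - ((real (Suc n))\<^sup>2 / 3 + 8 * real (Suc n) / 9 + 20/27) / 4 ^ Suc n"
      by (simp add: field_simps power2_eq_square)
    with Suc show ?case by (simp only: sum.lessThan_Suc)
  qed simp
  also have "\<dots> \<le> 20/27" by simp
  finally show ?thesis by simp
qed

lemma inverse_power_diff_bound:
  fixes s t :: real
  assumes "1 \<le> s" "1 \<le> t"
  shows "\<bar>1 / s ^ b - 1 / t ^ b\<bar> \<le> real b * \<bar>s - t\<bar>"
proof -
  have "1 \<le> s * t" using assms mult_mono[of 1 s 1 t] by simp
  have "\<bar>(1 / s) ^ b - (1 / t) ^ b\<bar> \<le> real b * \<bar>1 / s - 1 / t\<bar>"
    using norm_power_diff[of "1 / s" "1 / t" b] assms by simp
  also have "\<bar>1 / s - 1 / t\<bar> = \<bar>s - t\<bar> / (s * t)"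
    using assms by (simp add: field_simps abs_mult abs_divide)
  also have "\<dots> \<le> \<bar>s - t\<bar> / 1"
    using \<open>1 \<le> s * t\<close> by (intro divide_left_mono) auto
  finally show ?thesis by (simp add: power_divide mult_left_mono)
qed

section \<open>Arrays, their blocks and the pairing\<close>

text \<open>
  The second index of an array starts at \<open>1\<close>; the shift turns a block into an ordinary sequence.
\<close>

definition block :: "(nat \<times> nat \<Rightarrow> real) \<Rightarrow> nat \<Rightarrow> nat \<Rightarrow> real" where
  "block v b n = v (b, Suc n)"

abbreviation summable_array :: "(nat \<times> nat \<Rightarrow> real) \<Rightarrow> bool" where
  "summable_array a \<equiv> (\<lambda>i. norm (a i)) summable_on idx"

lemma bij_Suc_positive: "bij_betw Suc UNIV {1..}"
  by (rule bij_betwI[where g = "\<lambda>n. n - 1"]) auto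

lemma has_sum_block_iff: "((\<lambda>j. v (b, j)) has_sum S) {1..} \<longleftrightarrow> (block v b has_sum S) UNIV"
  unfolding block_def[abs_def]
  using has_sum_reindex_bij_betw[OF bij_Suc_positive, of "\<lambda>j. v (b, j)"] by simp

lemma summable_on_block:
  fixes v :: "nat \<times> nat \<Rightarrow> real"
  assumes "v summable_on idx"
  shows "block v b summable_on UNIV"
  using summable_on_SigmaD1[of "\<lambda>i j. v (i, j)" UNIV "\<lambda>_. {1..}" b] assms
    has_sum_block_iff[of v b] by (auto simp: idx_def summable_on_def)

lemma summable_abs_block:
  assumes "summable_array a"
  shows "summable (\<lambda>n. \<bar>block a b n\<bar>)"
  using summable_on_imp_summable[OF summable_on_block[OF assms, of b]] by (simp add: block_def[abs_def])

lemma summable_block: "summable_array a \<Longrightarrow> summable (block a b)"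
  by (rule summable_rabs_cancel[OF summable_abs_block])

lemma sums_of_blocks:
  fixes v :: "nat \<times> nat \<Rightarrow> real"
  assumes v: "(v has_sum S) idx" and blocks: "\<And>b. block v b sums g b"
  shows "g sums S"
proof (rule has_sum_imp_sums, rule has_sum_SigmaD)
  show "(v has_sum S) (UNIV \<times> {1..})" using v by (simp add: idx_def)
  fix b :: nat
  have "block v b summable_on UNIV" by (rule summable_on_block) (use v in \<open>auto simp: summable_on_def\<close>)
  then obtain l where l: "(block v b has_sum l) UNIV" by (auto simp: summable_on_def)
  then have "l = g b" using has_sum_imp_sums[OF l] blocks[of b] sums_unique2 by blast
  then show "((\<lambda>j. v (b, j)) has_sum g b) {1..}" using l by (simp only: has_sum_block_iff)
qed

lemma block_coord_tendsto_0: "block (coord x) b \<longlonglongrightarrow> 0"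
proof (rule LIMSEQ_I)
  fix e :: real assume e: "0 < e"
  have "finite ((\<lambda>n. (b, Suc n)) -` {i\<in>idx. e \<le> \<bar>coord x i\<bar>})"
    by (rule finite_vimageI[OF coord_finite[OF e]]) (auto intro: injI)
  then obtain N where N: "\<And>n. n \<in> (\<lambda>n. (b, Suc n)) -` {i\<in>idx. e \<le> \<bar>coord x i\<bar>} \<Longrightarrow> n < N"
    using finite_nat_set_iff_bounded by auto
  show "\<exists>N. \<forall>n\<ge>N. norm (block (coord x) b n - 0) < e"
    by (rule exI[of _ N]) (use N in \<open>auto simp: block_def idx_def not_less[symmetric]\<close>)
qed

lemma A_block_block:
  assumes "b \<ge> 1"
  shows "A_block x b (Suc n)
    = 4 ^ b * skew (block (coord x) b) n + 2 * (- 1) ^ n * (1 / \<bar>coord x (0, 1)\<bar> ^ b)"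
proof -
  have "(\<Sum>k = 1..n. (- 1) ^ (Suc n - k) * coord x (b, k))
      = (\<Sum>k<n. (- 1) ^ (n - k) * coord x (b, Suc k))"
    by (rule sum.reindex_bij_witness[of _ Suc "\<lambda>k. k - 1"]) (auto simp: Suc_diff_le)
  then show ?thesis by (simp add: A_block_def skew_def block_def)
qed

section \<open>The graph in terms of the image point\<close>

text \<open>
  The linear part of the graph of \<open>A\<close>: on the blocks \<open>b \<ge> 1\<close>, \<open>x\<close> is \<open>- 4 ^ - b\<close> times the Gossez
  operator applied to \<open>a\<close>. Nothing is imposed on \<open>x\<close> in the block \<open>b = 0\<close>.
\<close>

definition linked :: "c0 \<Rightarrow> (nat \<times> nat \<Rightarrow> real) \<Rightarrow> bool" where
  "linked x a \<longleftrightarrow> summable_array a \<and> (\<forall>j\<ge>2. a (0, j) = 0) \<and>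
     (\<forall>b\<ge>1. \<forall>n. 4 ^ b * block (coord x) b n = - (tail (block a b) n + tail (block a b) (Suc n)))"

lemma pairing_has_sum:
  assumes "summable_array a"
  shows "((\<lambda>i. coord x i * a i) has_sum blinfun_apply (l1_functional a) x) idx"
  unfolding l1_functional_apply[OF assms]
  by (rule has_sum_infsum[OF abs_summable_summable[OF l1_pairing_summable[OF assms]]])

text \<open>
  Every block \<open>b \<ge> 1\<close> contributes minus a weighted square to the pairing, determined by the sum
  of the block of \<open>a\<close> alone.
\<close>

lemma pairing_linked:
  assumes "linked x a"
  shows "(\<lambda>b. (suminf (block a (Suc b)))\<^sup>2 / 4 ^ Suc b)
    sums (coord x (0, 1) * a (0, 1) - blinfun_apply (l1_functional a) x)"
proof -
  have a: "summable_array a" using assms by (simp add: linked_def)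
  let ?v = "\<lambda>i. coord x i * a i"
  define g where "g b = (if b = 0 then coord x (0, 1) * a (0, 1)
      else - (suminf (block a b))\<^sup>2 / 4 ^ b)" for b
  have "block ?v b sums g b" for b
  proof (cases "b = 0")
    case True
    have "block ?v 0 = (\<lambda>n. if n = 0 then coord x (0, 1) * a (0, 1) else 0)"
      using assms by (auto simp: linked_def block_def)
    then show ?thesis
      using sums_single[of 0 "\<lambda>_. coord x (0, 1) * a (0, 1)"] True by (simp add: g_def)
  next
    case False
    have "(\<lambda>n. block (coord x) b n * block a b n) sums (- (suminf (block a b))\<^sup>2 / 4 ^ b)"
      by (rule quadratic_form_sums[OF summable_block[OF a]])
        (use assms False in \<open>auto simp: linked_def\<close>)
    then show ?thesis using False by (simp add: g_def block_def[abs_def])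
  qed
  then have "g sums blinfun_apply (l1_functional a) x"
    by (rule sums_of_blocks[OF pairing_has_sum[OF a]])
  then have "(\<lambda>b. g (Suc b)) sums (blinfun_apply (l1_functional a) x - g 0)"
    by (simp add: sums_Suc_iff)
  from sums_minus[OF this] show ?thesis by (simp add: g_def)
qed

lemma summable_array_add_scale:
  assumes "summable_array a" "summable_array c"
  shows "summable_array (\<lambda>i. a i + r * c i)"
proof (rule Infinite_Sum.abs_summable_on_comparison_test')
  show "(\<lambda>i. norm (a i) + \<bar>r\<bar> * norm (c i)) summable_on idx"
    by (intro summable_on_add summable_on_cmult_right assms)
  show "norm (a i + r * c i) \<le> norm (a i) + \<bar>r\<bar> * norm (c i)" for i
    using norm_triangle_ineq[of "a i" "r * c i"] by (simp add: abs_mult)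
qed

lemma l1_functional_add_scale:
  assumes "summable_array a" "summable_array c"
  shows "l1_functional (\<lambda>i. a i + r * c i) = l1_functional a + r *\<^sub>R l1_functional c"
proof (rule blinfun_eqI)
  fix x
  have "((\<lambda>i. coord x i * a i + r * (coord x i * c i)) has_sum
      blinfun_apply (l1_functional a) x + r * blinfun_apply (l1_functional c) x) idx"
    by (intro has_sum_add has_sum_cmult_right pairing_has_sum assms)
  then have "((\<lambda>i. coord x i * (a i + r * c i)) has_sum
      blinfun_apply (l1_functional a) x + r * blinfun_apply (l1_functional c) x) idx"
    by (simp add: algebra_simps)
  from has_sum_unique[OF pairing_has_sum[OF summable_array_add_scale[OF assms]] this]
  show "blinfun_apply (l1_functional (\<lambda>i. a i + r * c i)) x
      = blinfun_apply (l1_functional a + r *\<^sub>R l1_functional c) x"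
    by (simp add: blinfun.add_left blinfun.scaleR_left)
qed

lemma block_add_scale: "block (\<lambda>i. a i + r * c i) b = (\<lambda>n. block a b n + r * block c b n)"
  by (simp add: block_def fun_eq_iff)

lemma block_coord_add_scale:
  "block (coord (x + r *\<^sub>R y)) b n = block (coord x) b n + r * block (coord y) b n"
  by (simp add: block_def)

lemma suminf_block_add_scale:
  assumes "summable_array a" "summable_array c"
  shows "suminf (block (\<lambda>i. a i + r * c i) b) = suminf (block a b) + r * suminf (block c b)"
  using tail_add_scale[OF summable_block[OF assms(1)] summable_block[OF assms(2)], of b r b 0]
  by (simp add: block_add_scale tail_0)

lemma linked_add_scale:
  assumes "linked x a" "linked y c"
  shows "linked (x + r *\<^sub>R y) (\<lambda>i. a i + r * c i)"
proof -
  have a: "summable_array a" and c: "summable_array c" using assms by (auto simp: linked_def)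
  have "4 ^ b * block (coord (x + r *\<^sub>R y)) b n
      = - (tail (block (\<lambda>i. a i + r * c i) b) n + tail (block (\<lambda>i. a i + r * c i) b) (Suc n))"
    if "b \<ge> 1" for b n
  proof -
    have "4 ^ b * block (coord (x + r *\<^sub>R y)) b n
        = 4 ^ b * block (coord x) b n + r * (4 ^ b * block (coord y) b n)"
      unfolding block_coord_add_scale by (simp add: algebra_simps)
    also have "\<dots> = - (tail (block a b) n + tail (block a b) (Suc n))
        + r * - (tail (block c b) n + tail (block c b) (Suc n))"
      using assms that by (simp add: linked_def)
    finally show ?thesis
      unfolding block_add_scale tail_add_scale[OF summable_block[OF a] summable_block[OF c]]
      by (simp add: algebra_simps)
  qed
  then show ?thesis
    using assms summable_array_add_scale[OF a c] by (simp add: linked_def)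
qed

text \<open>
  The graph of \<open>A\<close>, with the image point \<open>a\<close> as the free parameter: \<open>a\<close> may be any summable array
  with prescribed block sums, and it determines \<open>x\<close> on the blocks \<open>b \<ge> 1\<close>.
\<close>

definition A_graph :: "c0 \<Rightarrow> (nat \<times> nat \<Rightarrow> real) \<Rightarrow> bool" where
  "A_graph x a \<longleftrightarrow> linked x a \<and> 1 < \<bar>coord x (0, 1)\<bar> \<and>
     a (0, 1) = coord x (0, 1) - sgn (coord x (0, 1)) \<and>
     (\<forall>b\<ge>1. suminf (block a b) = 1 / \<bar>coord x (0, 1)\<bar> ^ b)"

lemma A_graph_A_coords:
  assumes x: "x \<in> D"
  shows "A_graph x (A_coords x)"
proof -
  have s: "summable_array (A_coords x)" by (rule A_coords_summable[OF x])
  have eq: "4 ^ b * skew (block (coord x) b) n + 2 * (- 1) ^ n * (1 / \<bar>coord x (0, 1)\<bar> ^ b)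
      = block (A_coords x) b n" if "b \<ge> 1" for b n
    using A_block_block[OF that, of x n] that by (simp add: block_def A_coords_def)
  have "suminf (block (A_coords x) b) = 1 / \<bar>coord x (0, 1)\<bar> ^ b" if "b \<ge> 1" for b
    by (rule tail_of_skew(1)[OF summable_block[OF s] block_coord_tendsto_0 _ eq[OF that]]) simp
  moreover have "4 ^ b * block (coord x) b n
      = - (tail (block (A_coords x) b) n + tail (block (A_coords x) b) (Suc n))" if "b \<ge> 1" for b n
    by (rule tail_of_skew(2)[OF summable_block[OF s] block_coord_tendsto_0 _ eq[OF that]]) simp
  ultimately show ?thesis
    using s x by (simp add: A_graph_def linked_def D_def A_coords_def)
qed

lemma A_graph_imp_coords:
  assumes "A_graph x a" and "i \<in> idx"
  shows "A_coords x i = a i"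
proof -
  obtain b j where i: "i = (b, j)" "j \<ge> 1" using assms(2) by (auto simp: idx_def)
  show ?thesis
  proof (cases "b = 0")
    case True
    then show ?thesis using assms(1) i by (auto simp: A_graph_def linked_def A_coords_def)
  next
    case False
    obtain n where n: "j = Suc n" using i(2) by (cases j) auto
    have b: "b \<ge> 1" using False by simp
    have "4 ^ b * skew (block (coord x) b) n + 2 * (- 1) ^ n * suminf (block a b) = block a b n"
      by (rule skew_of_tail) (use assms(1) b in \<open>simp add: A_graph_def linked_def\<close>)
    moreover have "suminf (block a b) = 1 / \<bar>coord x (0, 1)\<bar> ^ b"
      using assms(1) b by (simp add: A_graph_def)
    ultimately show ?thesis
      using A_block_block[OF b, of x n] False by (simp add: i n A_coords_def block_def)
  qed
qed

lemma has_sum_ennreal: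
  assumes f: "(f has_sum S) B" and nonneg: "\<And>i. 0 \<le> f i"
  shows "((\<lambda>i. ennreal (f i)) has_sum ennreal S) B"
proof -
  have "sum (\<lambda>i. ennreal (f i)) = (\<lambda>F. ennreal (\<Sum>i\<in>F. f i))"
    by (rule ext) (simp add: nonneg)
  then show ?thesis
    using tendsto_ennrealI[OF f[unfolded has_sum_def]] by (simp add: has_sum_def)
qed

lemma infsum_ennreal_finite:
  fixes a :: "nat \<times> nat \<Rightarrow> real"
  assumes a: "(\<lambda>i. norm (a i)) summable_on B \<times> C"
  shows "(\<Sum>\<^sub>\<infinity>b\<in>B. \<Sum>\<^sub>\<infinity>j\<in>C. ennreal \<bar>a (b, j)\<bar>) < \<infinity>"
proof -
  obtain S where S: "((\<lambda>i. \<bar>a i\<bar>) has_sum S) (B \<times> C)"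
    using a by (auto simp: summable_on_def)
  have inner: "((\<lambda>j. \<bar>a (b, j)\<bar>) has_sum (\<Sum>\<^sub>\<infinity>j\<in>C. \<bar>a (b, j)\<bar>)) C" if "b \<in> B" for b
    by (rule has_sum_infsum, rule summable_on_SigmaD1[where f = "\<lambda>b j. \<bar>a (b, j)\<bar>" and A = B])
      (use a that in \<open>simp_all add: case_prod_unfold\<close>)
  have "((\<lambda>b. \<Sum>\<^sub>\<infinity>j\<in>C. \<bar>a (b, j)\<bar>) has_sum S) B"
    by (rule has_sum_SigmaD[OF S inner])
  then have "((\<lambda>b. ennreal (\<Sum>\<^sub>\<infinity>j\<in>C. \<bar>a (b, j)\<bar>)) has_sum ennreal S) B"
    by (rule has_sum_ennreal) (simp add: infsum_nonneg)
  moreover have "(\<Sum>\<^sub>\<infinity>j\<in>C. ennreal \<bar>a (b, j)\<bar>) = ennreal (\<Sum>\<^sub>\<infinity>j\<in>C. \<bar>a (b, j)\<bar>)" if "b \<in> B" for b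
    by (rule infsumI, rule has_sum_ennreal[OF inner[OF that]]) simp
  ultimately have "(\<Sum>\<^sub>\<infinity>b\<in>B. \<Sum>\<^sub>\<infinity>j\<in>C. ennreal \<bar>a (b, j)\<bar>) = ennreal S"
    by (simp add: infsumI cong: infsum_cong)
  then show ?thesis by simp
qed

lemma A_graph_imp_D:
  assumes "A_graph x a"
  shows "x \<in> D"
proof -
  have "summable_array a" using assms by (simp add: A_graph_def linked_def)
  then have "(\<lambda>i. norm (a i)) summable_on {1..} \<times> {1..}"
    by (rule summable_on_subset) (auto simp: idx_def)
  then have "(\<Sum>\<^sub>\<infinity>b\<in>{1..}. \<Sum>\<^sub>\<infinity>j\<in>{1..}. ennreal \<bar>a (b, j)\<bar>) < \<infinity>"
    by (rule infsum_ennreal_finite)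
  also have "(\<Sum>\<^sub>\<infinity>b\<in>{1..}. \<Sum>\<^sub>\<infinity>j\<in>{1..}. ennreal \<bar>a (b, j)\<bar>)
      = (\<Sum>\<^sub>\<infinity>b\<in>{1..}. \<Sum>\<^sub>\<infinity>j\<in>{1..}. ennreal \<bar>A_block x b j\<bar>)"
  proof (intro infsum_cong)
    fix b j :: nat assume "b \<in> {1..}" "j \<in> {1..}"
    then show "ennreal \<bar>a (b, j)\<bar> = ennreal \<bar>A_block x b j\<bar>"
      using A_graph_imp_coords[OF assms, of "(b, j)"] by (simp add: A_coords_def idx_def)
  qed
  finally show ?thesis using assms by (simp add: D_def A_graph_def)
qed

text \<open>
  The two descriptions of the graph agree: \<open>tail_of_skew\<close> gives one inclusion, \<open>skew_of_tail\<close>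
  the other.
\<close>

lemma A_op_iff: "p \<in> A_op x \<longleftrightarrow> (\<exists>a. A_graph x a \<and> p = l1_functional a)"
proof
  assume "p \<in> A_op x"
  then show "\<exists>a. A_graph x a \<and> p = l1_functional a"
    using A_graph_A_coords by (auto simp: A_op_def split: if_splits)
next
  assume "\<exists>a. A_graph x a \<and> p = l1_functional a"
  then obtain a where a: "A_graph x a" "p = l1_functional a" by blast
  have "l1_functional (A_coords x) = l1_functional a"
    unfolding l1_functional_def using A_graph_imp_coords[OF a(1)]
    by (intro arg_cong[of _ _ Blinfun] ext infsum_cong) simp
  then show "p \<in> A_op x" using a A_graph_imp_D by (simp add: A_op_def)
qed

section \<open>Monotonicity\<close>

text \<open>
  For equal signs this is an equality. For opposite signs the jump of size \<open>2\<close> in \<open>x - sgn x\<close>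
  is harmless because \<open>s + t - 2 \<ge> \<bar>s - t\<bar>\<close> whenever \<open>s, t \<ge> 1\<close>.
\<close>

lemma scalar_part_monotone:
  fixes x y :: real
  assumes "1 < \<bar>x\<bar>" "1 < \<bar>y\<bar>"
  shows "(\<bar>x\<bar> - \<bar>y\<bar>)\<^sup>2 \<le> (x - y) * ((x - sgn x) - (y - sgn y))"
proof -
  have opp: "(s - t)\<^sup>2 \<le> (s + t) * (s + t - 2)" if "1 < s" "1 < t" for s t :: real
  proof -
    have "(s + t) * (s + t - 2) - (s - t)\<^sup>2 = 2 * s * (t - 1) + 2 * t * (s - 1)"
      by (simp add: power2_eq_square algebra_simps)
    then show ?thesis using that by (smt (verit) mult_nonneg_nonneg)
  qed
  consider "x > 1" "y > 1" | "x < -1" "y < -1" | "x > 1" "y < -1" | "x < -1" "y > 1"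
    using assms by linarith
  then show ?thesis
  proof cases
    case 3
    then show ?thesis using opp[of x "-y"] by (simp add: algebra_simps)
  next
    case 4
    then show ?thesis using opp[of "-x" y] by (simp add: algebra_simps)
  qed (simp_all add: power2_eq_square algebra_simps)
qed

text \<open>
  With \<open>P\<close> the scalar term and \<open>Q\<close> the pairing, \<open>P - Q\<close> is the total loss in the blocks. It is bounded
  through its partial sums.
\<close>

lemma diff_le_by_square_weights:
  assumes lim: "g sums (P - Q)" and bound: "\<And>b. g b \<le> (real (Suc b))\<^sup>2 / 4 ^ Suc b * K" "0 \<le> K"
  shows "P - K \<le> Q"
proof -
  have "(\<Sum>b<n. g b) \<le> K" for n
  proof -
    have "(\<Sum>b<n. g b) \<le> (\<Sum>b<n. (real (Suc b))\<^sup>2 / 4 ^ Suc b) * K"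
      unfolding sum_distrib_right by (intro sum_mono bound)
    also have "\<dots> \<le> 1 * K" by (intro mult_right_mono sum_square_over_4_power bound)
    finally show ?thesis by simp
  qed
  then have "P - Q \<le> K" by (intro LIMSEQ_le_const2[OF lim[unfolded sums_def]]) auto
  then show ?thesis by simp
qed

lemma l1_functional_linked_diff:
  assumes "linked x a" "linked y c"
  shows "(\<lambda>b. (suminf (block a (Suc b)) - suminf (block c (Suc b)))\<^sup>2 / 4 ^ Suc b)
    sums ((coord x (0, 1) - coord y (0, 1)) * (a (0, 1) - c (0, 1))
      - blinfun_apply (l1_functional a - l1_functional c) (x - y))"
proof -
  have s: "summable_array a" "summable_array c" using assms by (auto simp: linked_def)
  show ?thesis
    using pairing_linked[OF linked_add_scale[OF assms, of "- 1"]]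
    by (simp add: l1_functional_add_scale[OF s, of "-1", simplified]
        suminf_block_add_scale[OF s, of "-1", simplified])
qed

text \<open>
  The scalar coordinate contributes at least \<open>(s - t)\<^sup>2\<close>, where \<open>s\<close> and \<open>t\<close> are the moduli of the
  distinguished coordinates. The blocks lose at most \<open>\<Sum>b. b\<^sup>2 / 4 ^ b\<close> times this, and that series
  has a sum below \<open>1\<close>.
\<close>

lemma A_graph_monotone:
  assumes "A_graph x a" "A_graph y c"
  shows "0 \<le> blinfun_apply (l1_functional a - l1_functional c) (x - y)"
proof -
  let ?s = "\<bar>coord x (0, 1)\<bar>" and ?t = "\<bar>coord y (0, 1)\<bar>"
  have st: "1 < ?s" "1 < ?t" using assms by (auto simp: A_graph_def)
  have "(1 / ?s ^ Suc b - 1 / ?t ^ Suc b)\<^sup>2 / 4 ^ Suc b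
      \<le> (real (Suc b))\<^sup>2 / 4 ^ Suc b * (?s - ?t)\<^sup>2" for b
  proof -
    have "\<bar>1 / ?s ^ Suc b - 1 / ?t ^ Suc b\<bar>\<^sup>2 \<le> (real (Suc b) * \<bar>?s - ?t\<bar>)\<^sup>2"
      by (rule power_mono[OF inverse_power_diff_bound]) (use st in auto)
    then have "(1 / ?s ^ Suc b - 1 / ?t ^ Suc b)\<^sup>2 \<le> (real (Suc b))\<^sup>2 * (?s - ?t)\<^sup>2"
      by (simp only: power2_abs power_mult_distrib)
    then show ?thesis by (simp add: divide_right_mono)
  qed
  moreover have "(\<lambda>b. (1 / ?s ^ Suc b - 1 / ?t ^ Suc b)\<^sup>2 / 4 ^ Suc b)
      sums ((coord x (0, 1) - coord y (0, 1)) * (a (0, 1) - c (0, 1))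
        - blinfun_apply (l1_functional a - l1_functional c) (x - y))"
    using l1_functional_linked_diff[of x a y c] assms by (simp add: A_graph_def)
  ultimately have "(coord x (0, 1) - coord y (0, 1)) * (a (0, 1) - c (0, 1)) - (?s - ?t)\<^sup>2
      \<le> blinfun_apply (l1_functional a - l1_functional c) (x - y)"
    by (intro diff_le_by_square_weights) auto
  moreover have "(?s - ?t)\<^sup>2 \<le> (coord x (0, 1) - coord y (0, 1)) * (a (0, 1) - c (0, 1))"
    using scalar_part_monotone[OF st] assms by (simp add: A_graph_def)
  ultimately show ?thesis by linarith
qed

section \<open>Maximality\<close>

text \<open>
  The witness puts the prescribed sum of each block of \<open>a\<close> into the first entry. It is summable
  because \<open>\<bar>s\<bar> > 1\<close>.
\<close>

lemma A_graph_exists: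
  assumes s: "1 < \<bar>s\<bar>"
  obtains x a where "A_graph x a" "coord x (0, 1) = s"
proof -
  define xs where "xs = (\<lambda>(b::nat, j::nat).
    if j = 1 then (if b = 0 then s else - ((1 / (4 * \<bar>s\<bar>)) ^ b)) else 0)"
  define a where "a = (\<lambda>(b::nat, j::nat).
    if j = 1 then (if b = 0 then s - sgn s else 1 / \<bar>s\<bar> ^ b) else 0)"
  have fin: "finite {i\<in>idx. e \<le> \<bar>xs i\<bar>}" if e: "0 < e" for e
  proof -
    have "(\<lambda>b. (1 / (4 * \<bar>s\<bar>)) ^ b) \<longlonglongrightarrow> 0" using s by (intro LIMSEQ_realpow_zero) auto
    then obtain N where N: "\<And>b. b \<ge> N \<Longrightarrow> \<bar>(1 / (4 * \<bar>s\<bar>)) ^ b\<bar> < e"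
      using LIMSEQ_D[OF _ e] by fastforce
    have "{i\<in>idx. e \<le> \<bar>xs i\<bar>} \<subseteq> {..N} \<times> {1}"
    proof safe
      fix b j assume i: "e \<le> \<bar>xs (b, j)\<bar>"
      then show "j = 1" using e by (simp add: xs_def split: if_splits)
      then show "b \<le> N" using N[of b] i by (cases "b \<le> N") (auto simp: xs_def split: if_splits)
    qed
    then show ?thesis by (rule finite_subset) simp
  qed
  define x where "x = Abs_c0 xs"
  have x: "coord x = xs" unfolding x_def
    by (rule Abs_c0_inverse) (use fin in \<open>auto simp: idx_def xs_def\<close>)
  have "summable_array a"
  proof -
    have "summable (\<lambda>b. (1 / \<bar>s\<bar>) ^ b)" using s by (intro summable_geometric) simp
    then have "summable (\<lambda>b. norm (a (b, 1)))"
      using s by (subst summable_cong[where g = "\<lambda>b. (1 / \<bar>s\<bar>) ^ b"])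
        (auto simp: a_def power_divide eventually_at_top_linorder intro!: exI[of _ 1])
    then have "(\<lambda>b. norm (a (b, 1))) summable_on UNIV"
      by (intro norm_summable_imp_summable_on) simp
    then have "(\<lambda>i. norm (a i)) summable_on (\<lambda>b. (b, 1)) ` UNIV"
      by (subst summable_on_reindex) (auto intro: injI simp: o_def)
    then show ?thesis
      by (rule summable_on_cong_neutral[THEN iffD1, rotated -1])
        (auto simp: idx_def a_def split: if_splits)
  qed
  moreover have block: "suminf (block a b) = 1 / \<bar>s\<bar> ^ b" if "b \<ge> 1" for b
  proof -
    have "block a b = (\<lambda>n. if n = 0 then 1 / \<bar>s\<bar> ^ b else 0)"
      using that by (auto simp: block_def a_def)
    then show ?thesis using sums_single[of 0 "\<lambda>_. 1 / \<bar>s\<bar> ^ b"] by (simp add: sums_iff)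
  qed
  moreover have "tail (block a b) n = (if n = 0 then 1 / \<bar>s\<bar> ^ b else 0)" if "b \<ge> 1" for b n
  proof (induction n)
    case 0
    then show ?case using block[OF that] by (simp add: tail_0)
  next
    case (Suc n)
    then show ?case using that by (simp add: tail_Suc block_def a_def)
  qed
  ultimately have "A_graph x a"
    using s by (auto simp: A_graph_def linked_def x xs_def block_def a_def power_divide power_mult_distrib)
  moreover have "coord x (0, 1) = s" by (simp add: x xs_def)
  ultimately show thesis by (rule that)
qed

lemma A_graph_perturb:
  assumes g: "A_graph x a" and l: "linked \<xi> \<delta>"
    and z: "coord \<xi> (0, 1) = 0" "\<delta> (0, 1) = 0" "\<And>b. b \<ge> 1 \<Longrightarrow> suminf (block \<delta> b) = 0"
  shows "A_graph (x + r *\<^sub>R \<xi>) (\<lambda>i. a i + r * \<delta> i)"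
proof -
  have s: "summable_array a" "summable_array \<delta>" using g l by (auto simp: A_graph_def linked_def)
  have "linked (x + r *\<^sub>R \<xi>) (\<lambda>i. a i + r * \<delta> i)"
    using g l by (intro linked_add_scale) (auto simp: A_graph_def)
  then show ?thesis
    using g z by (simp add: A_graph_def suminf_block_add_scale[OF s])
qed

text \<open>
  On the graph the pairing depends only on the distinguished coordinate, so it stays constant along
  the perturbations of \<open>A_graph_perturb\<close>.
\<close>

lemma A_graph_pairing_cong:
  assumes "A_graph x a" "A_graph y c" "coord x (0, 1) = coord y (0, 1)"
  shows "blinfun_apply (l1_functional a) x = blinfun_apply (l1_functional c) y"
  using sums_unique2[OF pairing_linked[of x a] pairing_linked[of y c, THEN sums_cong[THEN iffD1, rotated]]]
    assms by (simp add: A_graph_def)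

lemma affine_nonneg_imp_zero:
  fixes k m :: real
  assumes "\<And>r. 0 \<le> m - r * k"
  shows "k = 0"
  using assms[of "(m + 1) / k"] by (cases "k = 0") auto

definition related_to_A :: "c0 \<Rightarrow> (nat \<times> nat \<Rightarrow> real) \<Rightarrow> bool" where
  "related_to_A z p \<longleftrightarrow> summable_array p \<and>
     (\<forall>x a. A_graph x a \<longrightarrow> 0 \<le> blinfun_apply (l1_functional p - l1_functional a) (z - x))"

text \<open>
  Along the line \<open>x + r \<xi>\<close>, \<open>a + r \<delta>\<close> in the graph the quadratic term is constant, so the
  monotonicity inequality is affine in \<open>r\<close>. It holds for all real \<open>r\<close>, so its slope vanishes.
\<close>

lemma related_annihilates:
  assumes p: "related_to_A z p" and l: "linked \<xi> \<delta>"
    and zero: "coord \<xi> (0, 1) = 0" "\<delta> (0, 1) = 0" "\<And>b. b \<ge> 1 \<Longrightarrow> suminf (block \<delta> b) = 0"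
  shows "blinfun_apply (l1_functional \<delta>) z + blinfun_apply (l1_functional p) \<xi> = 0"
proof -
  obtain x a where g: "A_graph x a" by (rule A_graph_exists[of 2]) auto
  have s: "summable_array a" "summable_array \<delta>" using g l by (auto simp: A_graph_def linked_def)
  show ?thesis
  proof (rule affine_nonneg_imp_zero)
    fix r
    let ?x = "x + r *\<^sub>R \<xi>" and ?a = "\<lambda>i. a i + r * \<delta> i"
    have g': "A_graph ?x ?a" by (rule A_graph_perturb[OF g l zero])
    have "0 \<le> blinfun_apply (l1_functional p - l1_functional ?a) (z - ?x)"
      using p g' by (auto simp: related_to_A_def)
    also have "\<dots> = blinfun_apply (l1_functional p) z - blinfun_apply (l1_functional ?a) z
        - blinfun_apply (l1_functional p) ?x + blinfun_apply (l1_functional ?a) ?x"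
      by (simp add: blinfun.diff_left blinfun.diff_right)
    also have "blinfun_apply (l1_functional ?a) ?x = blinfun_apply (l1_functional a) x"
      by (rule A_graph_pairing_cong[OF g' g]) (use zero in simp)
    finally show "0 \<le> (blinfun_apply (l1_functional p) z - blinfun_apply (l1_functional a) z
        - blinfun_apply (l1_functional p) x + blinfun_apply (l1_functional a) x)
        - r * (blinfun_apply (l1_functional \<delta>) z + blinfun_apply (l1_functional p) \<xi>)"
      by (simp add: l1_functional_add_scale[OF s] blinfun.add_left blinfun.add_right
          blinfun.scaleR_left blinfun.scaleR_right algebra_simps)
  qed
qed

text \<open>
  The direction is a unit array of the block \<open>b = 0\<close>, on which the graph places no condition.
\<close>

lemma related_block_0:
  assumes p: "related_to_A z p" and j: "j \<ge> 2"
  shows "p (0, j) = 0"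
proof -
  have i: "(0, j) \<in> idx" using j by (simp add: idx_def)
  have r0: "block (\<lambda>_. 0) b = (\<lambda>_. 0)" for b by (simp add: block_def fun_eq_iff)
  have "linked (unit_array (0, j)) (\<lambda>_. 0)"
    by (simp add: linked_def r0 tail_def block_def coord_unit_array[OF i])
  then have "blinfun_apply (l1_functional (\<lambda>_. 0)) z
      + blinfun_apply (l1_functional p) (unit_array (0, j)) = 0"
    by (rule related_annihilates[OF p]) (use j in \<open>simp_all add: r0 coord_unit_array[OF i]\<close>)
  then show ?thesis
    using l1_functional_unit_array[OF _ i] p by (simp add: related_to_A_def l1_functional_apply)
qed

text \<open>
  The direction has \<open>\<delta> = e\<^sub>n - e\<^sub>n\<^sub>+\<^sub>1\<close> within block \<open>b\<close>. Its only nonzero tail is \<open>- 1\<close>, at position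
  \<open>n + 1\<close>, so the partner is \<open>\<xi> = 4 ^ - b (e\<^sub>n + e\<^sub>n\<^sub>+\<^sub>1)\<close>.
\<close>

lemma related_neighbours:
  assumes p: "related_to_A z p" and b: "b \<ge> 1"
  shows "4 ^ b * (block (coord z) b n - block (coord z) b (Suc n)) = - (block p b n + block p b (Suc n))"
proof -
  let ?i = "(b, Suc n)" and ?k = "(b, Suc (Suc n))"
  have ik: "?i \<in> idx" "?k \<in> idx" by (auto simp: idx_def)
  have sp: "summable_array p" using p by (simp add: related_to_A_def)
  define \<delta> :: "nat \<times> nat \<Rightarrow> real" where "\<delta> i = (if i = ?i then 1 else if i = ?k then - 1 else 0)" for i
  define \<xi> where "\<xi> = (1 / 4 ^ b) *\<^sub>R (unit_array ?i + unit_array ?k)"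
  have \<delta>: "summable_array \<delta>"
    by (rule summable_on_cong_neutral[where S = "{?i, ?k}", THEN iffD1])
      (use ik in \<open>auto simp: \<delta>_def\<close>)
  have partial: "(\<Sum>m<N. block \<delta> b' m) = (if b' = b \<and> N = Suc n then 1 else 0)" for b' N
    by (induction N) (auto simp: block_def \<delta>_def)
  have total: "suminf (block \<delta> b') = 0" for b'
  proof -
    have "block \<delta> b' sums (\<Sum>m<Suc (Suc n). block \<delta> b' m)"
      by (rule sums_finite) (auto simp: block_def \<delta>_def)
    then show ?thesis by (simp only: partial) (simp add: sums_iff)
  qed
  have "linked \<xi> \<delta>"
    using \<delta> b unfolding linked_def tail_def total partial
    by (auto simp: \<xi>_def block_def coord_unit_array[OF ik(1)] coord_unit_array[OF ik(2)] \<delta>_def)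
  then have "blinfun_apply (l1_functional \<delta>) z + blinfun_apply (l1_functional p) \<xi> = 0"
    by (rule related_annihilates[OF p])
      (use b total in \<open>simp_all add: \<xi>_def \<delta>_def coord_unit_array[OF ik(1)] coord_unit_array[OF ik(2)]\<close>)
  moreover have "blinfun_apply (l1_functional \<delta>) z = coord z ?i - coord z ?k"
  proof -
    have "blinfun_apply (l1_functional \<delta>) z = (\<Sum>\<^sub>\<infinity>i\<in>{?i, ?k}. coord z i * \<delta> i)"
      unfolding l1_functional_apply[OF \<delta>]
      by (rule infsum_cong_neutral) (use ik in \<open>auto simp: \<delta>_def\<close>)
    then show ?thesis by (simp add: \<delta>_def)
  qed
  moreover have "blinfun_apply (l1_functional p) \<xi> = (p ?i + p ?k) / 4 ^ b"
    by (simp add: \<xi>_def blinfun.scaleR_right blinfun.add_right l1_functional_unit_array[OF sp ik(1)]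
        l1_functional_unit_array[OF sp ik(2)])
  ultimately have "coord z ?i - coord z ?k = - (p ?i + p ?k) / 4 ^ b"
    by (simp add: field_simps)
  then show ?thesis by (simp add: block_def)
qed

text \<open>
  By the relation between neighbours, the defect of the linking equation is constant along each
  block; it tends to zero because \<open>z\<close> is a null array and \<open>p\<close> is summable.
\<close>

lemma related_imp_linked:
  assumes p: "related_to_A z p"
  shows "linked z p"
proof -
  have sp: "summable_array p" using p by (simp add: related_to_A_def)
  have "4 ^ b * block (coord z) b n = - (tail (block p b) n + tail (block p b) (Suc n))"
    if b: "b \<ge> 1" for b n
  proof -
    define h where "h n = 4 ^ b * block (coord z) b n + (tail (block p b) n + tail (block p b) (Suc n))" for n
    have "h n = h (Suc n)" for n
      using related_neighbours[OF p b, of n] by (simp add: h_def tail_Suc algebra_simps)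
    then have const: "h n = h 0" for n by (induction n) auto
    then have "h = (\<lambda>_. h 0)" by blast
    moreover have "h \<longlonglongrightarrow> 4 ^ b * 0 + (0 + 0)" unfolding h_def
      by (intro tendsto_intros block_coord_tendsto_0 tail_tendsto_0 LIMSEQ_Suc summable_block sp)
    ultimately have "h 0 = 0" by (metis LIMSEQ_const_iff add_0 mult_zero_right)
    then have "h n = 0" using const by simp
    then show ?thesis by (simp add: h_def add_eq_0_iff)
  qed
  then show ?thesis using sp related_block_0[OF p] by (simp add: linked_def)
qed

text \<open>
  Once \<open>z\<close> and \<open>p\<close> are linked, monotonicity against a graph point with distinguished coordinate \<open>s\<close>
  says that the block losses together stay below the scalar term; one of them is kept.
\<close>

lemma related_scalar_bound:
  assumes p: "related_to_A z p" and b: "b \<ge> 1" and s: "1 < \<bar>s\<bar>"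
  shows "(suminf (block p b) - 1 / \<bar>s\<bar> ^ b)\<^sup>2 / 4 ^ b
    \<le> (coord z (0, 1) - s) * (p (0, 1) - (s - sgn s))"
proof -
  obtain x a where g: "A_graph x a" and x: "coord x (0, 1) = s" by (rule A_graph_exists[OF s])
  define t where "t b = (suminf (block p b) - suminf (block a b))\<^sup>2 / 4 ^ b" for b
  have sums: "(\<lambda>b. t (Suc b)) sums ((coord z (0, 1) - s) * (p (0, 1) - (s - sgn s))
      - blinfun_apply (l1_functional p - l1_functional a) (z - x))"
    using l1_functional_linked_diff[OF related_imp_linked[OF p], of x a] g x
    by (simp add: A_graph_def t_def)
  \<comment> \<open>The series starts at block \<open>1\<close>, so block \<open>b\<close> is its term number \<open>b - 1\<close>.\<close>
  have "(\<Sum>b\<in>{b - 1}. t (Suc b)) \<le> suminf (\<lambda>b. t (Suc b))"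
    by (rule sum_le_suminf) (use sums in \<open>auto simp: sums_iff t_def\<close>)
  moreover have "0 \<le> blinfun_apply (l1_functional p - l1_functional a) (z - x)"
    using p g by (auto simp: related_to_A_def)
  ultimately show ?thesis using sums b g x by (simp add: sums_iff t_def A_graph_def)
qed

lemma le_multiple_imp_zero:
  fixes v K d :: real
  assumes "0 < d" and "\<And>h. 0 < h \<Longrightarrow> h < d \<Longrightarrow> \<bar>v\<bar> \<le> K * h"
  shows "v = 0"
proof -
  have "\<bar>v\<bar> \<le> K * 0"
  proof (rule tendsto_lowerbound)
    show "((\<lambda>h. K * h) \<longlongrightarrow> K * 0) (at_right 0)" by (intro tendsto_intros)
    show "\<forall>\<^sub>F h in at_right 0. \<bar>v\<bar> \<le> K * h"
      unfolding eventually_at_right_field using assms by blast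
  qed simp
  then show ?thesis by simp
qed

text \<open>
  Let \<open>s\<close> tend to the distinguished coordinate \<open>t\<close> of \<open>z\<close>. From both sides this gives
  \<open>p (0, 1) = t - sgn t\<close>. The right-hand side of the bound is then \<open>(t - s)\<^sup>2\<close>, which forces the
  sums of the blocks of \<open>p\<close> to be the powers of \<open>1 / \<bar>t\<bar>\<close>.
\<close>

lemma related_imp_A_graph_large:
  assumes p: "related_to_A z p" and z: "1 < \<bar>coord z (0, 1)\<bar>"
  shows "A_graph z p"
proof -
  define t where "t = coord z (0, 1)"
  define q where "q = p (0, 1)"
  have t: "1 < \<bar>t\<bar>" using z by (simp add: t_def)
  have bound: "(suminf (block p b) - 1 / \<bar>s\<bar> ^ b)\<^sup>2 / 4 ^ b \<le> (t - s) * (q - (s - sgn s))"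
    if "b \<ge> 1" "1 < \<bar>s\<bar>" for b s
    using related_scalar_bound[OF p that] by (simp add: t_def q_def)
  have near: "1 < \<bar>t + h\<bar>" "sgn (t + h) = sgn t" if "\<bar>h\<bar> < \<bar>t\<bar> - 1" for h
    using that t by (auto simp: sgn_if abs_if split: if_splits)
  have "q - (t - sgn t) = 0"
  proof (rule le_multiple_imp_zero[of "\<bar>t\<bar> - 1" _ 1])
    fix h assume h: "0 < h" "h < \<bar>t\<bar> - 1"
    have "0 \<le> (t - s) * (q - (s - sgn s))" if "1 < \<bar>s\<bar>" for s
      by (rule order_trans[OF _ bound[OF order_refl that]]) simp
    from this[of "t + h"] this[of "t + (- h)"] near[of h] near[of "- h"] h
    have "0 \<le> (- h) * (q - (t + h - sgn t))" "0 \<le> h * (q - (t - h - sgn t))" by auto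
    then have "q - (t + h - sgn t) \<le> 0" "0 \<le> q - (t - h - sgn t)"
      using h by (simp_all add: zero_le_mult_iff mult_le_0_iff)
    then show "\<bar>q - (t - sgn t)\<bar> \<le> 1 * h" by auto
  qed (use t in simp)
  then have q: "q = t - sgn t" by simp
  have "suminf (block p b) - 1 / \<bar>t\<bar> ^ b = 0" if b: "b \<ge> 1" for b
  proof (rule le_multiple_imp_zero[of "\<bar>t\<bar> - 1" _ "2 ^ b + real b"])
    fix h assume h: "0 < h" "h < \<bar>t\<bar> - 1"
    have "(4::real) ^ b = (2 ^ b)\<^sup>2" by (simp add: power2_eq_square power_mult_distrib[symmetric])
    moreover have "(suminf (block p b) - 1 / \<bar>t + h\<bar> ^ b)\<^sup>2 / 4 ^ b \<le> h\<^sup>2"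
      using bound[OF b near(1), of h] near(2)[of h] h q by (simp add: power2_eq_square)
    ultimately have "(suminf (block p b) - 1 / \<bar>t + h\<bar> ^ b)\<^sup>2 \<le> (2 ^ b * h)\<^sup>2"
      by (simp add: field_simps power_mult_distrib)
    then have "\<bar>suminf (block p b) - 1 / \<bar>t + h\<bar> ^ b\<bar> \<le> 2 ^ b * h"
      using h by (simp add: abs_le_square_iff[symmetric])
    moreover have "\<bar>1 / \<bar>t + h\<bar> ^ b - 1 / \<bar>t\<bar> ^ b\<bar> \<le> real b * \<bar>\<bar>t + h\<bar> - \<bar>t\<bar>\<bar>"
      by (rule inverse_power_diff_bound) (use near(1)[of h] h t in auto)
    moreover have "real b * \<bar>\<bar>t + h\<bar> - \<bar>t\<bar>\<bar> \<le> real b * h"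
      using h by (intro mult_left_mono) auto
    ultimately show "\<bar>suminf (block p b) - 1 / \<bar>t\<bar> ^ b\<bar> \<le> (2 ^ b + real b) * h"
      unfolding distrib_right by linarith
  qed (use t in simp)
  then show ?thesis
    using related_imp_linked[OF p] t q by (simp add: A_graph_def t_def q_def)
qed

text \<open>
  Let \<open>s\<close> tend to \<open>1\<close> and to \<open>- 1\<close>. A summable \<open>p\<close> cannot have all its block sums equal to \<open>1\<close>,
  so in the limit both \<open>(t - 1) q\<close> and \<open>(t + 1) q\<close> are positive, which is absurd for \<open>\<bar>t\<bar> \<le> 1\<close>.
  The summability of \<open>p\<close> thus excludes the whole gap \<open>[- 1, 1]\<close> from the domain of \<open>A\<close>.
\<close>

lemma not_related_small:
  assumes p: "related_to_A z p" and z: "\<bar>coord z (0, 1)\<bar> \<le> 1"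
  shows False
proof -
  define t where "t = coord z (0, 1)"
  define q where "q = p (0, 1)"
  have sp: "summable_array p" using p by (simp add: related_to_A_def)
  have "(\<lambda>b. suminf (block p b)) sums (infsum p idx)"
    by (rule sums_of_blocks[OF has_sum_infsum[OF abs_summable_summable[OF sp]]])
      (rule summable_sums[OF summable_block[OF sp]])
  then have "(\<lambda>b. suminf (block p b)) \<longlonglongrightarrow> 0"
    by (intro summable_LIMSEQ_zero) (simp add: sums_iff)
  then obtain N where N: "\<And>b. b \<ge> N \<Longrightarrow> \<bar>suminf (block p b)\<bar> < 1"
    using LIMSEQ_D[of _ 0 1] by fastforce
  obtain b where b: "b \<ge> 1" "suminf (block p b) \<noteq> 1"
    using N[of "Suc N"] by (intro that[of "Suc N"]) auto
  define P where "P = suminf (block p b)"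
  have bound: "(P - 1 / \<bar>s\<bar> ^ b)\<^sup>2 / 4 ^ b \<le> (t - s) * (q - (s - sgn s))" if "1 < \<bar>s\<bar>" for s
    using related_scalar_bound[OF p b(1) that] by (simp add: t_def q_def P_def)
  have lim: "((\<lambda>h. (P - 1 / (1 + h) ^ b)\<^sup>2 / 4 ^ b) \<longlongrightarrow> (P - 1 / (1 + 0) ^ b)\<^sup>2 / 4 ^ b) (at_right 0)"
    by (intro tendsto_intros) auto
  have pos: "0 < (P - 1 / (1 + 0) ^ b)\<^sup>2 / 4 ^ b" using b(2) by (simp add: P_def)
  have "(P - 1 / (1 + 0) ^ b)\<^sup>2 / 4 ^ b \<le> (t - (1 + 0)) * (q - 0)"
  proof (rule tendsto_le[OF _ _ lim])
    show "((\<lambda>h. (t - (1 + h)) * (q - h)) \<longlongrightarrow> (t - (1 + 0)) * (q - 0)) (at_right 0)"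
      by (intro tendsto_intros)
    show "\<forall>\<^sub>F h in at_right 0. (P - 1 / (1 + h) ^ b)\<^sup>2 / 4 ^ b \<le> (t - (1 + h)) * (q - h)"
      using eventually_at_right_less[of 0]
    proof (rule eventually_mono)
      fix h :: real assume "0 < h"
      then show "(P - 1 / (1 + h) ^ b)\<^sup>2 / 4 ^ b \<le> (t - (1 + h)) * (q - h)"
        using bound[of "1 + h"] by simp
    qed
  qed simp
  then have 1: "0 < (t - 1) * q" using pos by simp
  have "(P - 1 / (1 + 0) ^ b)\<^sup>2 / 4 ^ b \<le> (t + (1 + 0)) * (q + 0)"
  proof (rule tendsto_le[OF _ _ lim])
    show "((\<lambda>h. (t + (1 + h)) * (q + h)) \<longlongrightarrow> (t + (1 + 0)) * (q + 0)) (at_right 0)"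
      by (intro tendsto_intros)
    show "\<forall>\<^sub>F h in at_right 0. (P - 1 / (1 + h) ^ b)\<^sup>2 / 4 ^ b \<le> (t + (1 + h)) * (q + h)"
      using eventually_at_right_less[of 0]
    proof (rule eventually_mono)
      fix h :: real assume "0 < h"
      then show "(P - 1 / (1 + h) ^ b)\<^sup>2 / 4 ^ b \<le> (t + (1 + h)) * (q + h)"
        using bound[of "- (1 + h)"] by (simp add: abs_if algebra_simps)
    qed
  qed simp
  then have 2: "0 < (t + 1) * q" using pos by simp
  from 1 2 z show False by (auto simp: zero_less_mult_iff t_def)
qed

theorem maximally_monotone_A_op: "maximally_monotone A_op"
  unfolding maximally_monotone_def monotone_operator_def
proof (intro conjI allI impI)
  show "\<forall>(x, a)\<in>gra A_op. \<forall>(y, c)\<in>gra A_op. 0 \<le> blinfun_apply (a - c) (x - y)"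
    by (auto simp: gra_def A_op_iff A_graph_monotone)
next
  fix z \<pi> assume rel: "\<forall>(x, a)\<in>gra A_op. 0 \<le> blinfun_apply (\<pi> - a) (z - x)"
  obtain p where p: "summable_array p" "\<pi> = l1_functional p" by (rule l1_functional_surj)
  have "related_to_A z p" using rel p by (auto simp: related_to_A_def gra_def A_op_iff)
  then have "A_graph z p"
    using related_imp_A_graph_large not_related_small linorder_not_le by metis
  then show "(z, \<pi>) \<in> gra A_op" using p by (auto simp: gra_def A_op_iff)
qed

section \<open>The normal cone of the half-space\<close>

definition coord_01 :: "c0 \<Rightarrow>\<^sub>L real" where
  "coord_01 = Blinfun (\<lambda>x. coord x (0, 1))"

lemma coord_01_apply [simp]: "blinfun_apply coord_01 x = coord x (0, 1)"
  by (simp add: coord_01_def bounded_linear_Blinfun_apply[OF bounded_linear_coord])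

text \<open>
  The multipliers \<open>- r\<close> times the distinguished coordinate, at the boundary point \<open>w\<close> and for \<open>r\<close>
  large, force a related \<open>z\<close> into the half-space. The zero multiplier at all points of the
  half-space then says that \<open>p\<close> is normal at \<open>z\<close>.
\<close>

lemma maximally_monotone_normal_cone_C_half: "maximally_monotone (normal_cone C_half)"
  unfolding maximally_monotone_def monotone_operator_def
proof (intro conjI allI impI)
  show "\<forall>(x, a)\<in>gra (normal_cone C_half). \<forall>(y, c)\<in>gra (normal_cone C_half).
      0 \<le> blinfun_apply (a - c) (x - y)"
  proof safe
    fix x a y c assume "(x, a) \<in> gra (normal_cone C_half)" "(y, c) \<in> gra (normal_cone C_half)"
    then have "blinfun_apply a (y - x) \<le> 0" "blinfun_apply c (x - y) \<le> 0"
      by (auto simp: gra_def normal_cone_def split: if_splits)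
    then show "0 \<le> blinfun_apply (a - c) (x - y)"
      by (simp add: blinfun.diff_left blinfun.diff_right)
  qed
next
  fix z p assume rel: "\<forall>(x, a)\<in>gra (normal_cone C_half). 0 \<le> blinfun_apply (p - a) (z - x)"
  define w where "w = - unit_array (0, 1)"
  have w: "coord w (0, 1) = - 1" using one_idx by (simp add: w_def coord_unit_array)
  have "0 \<le> blinfun_apply p (z - w) - r * (- 1 - coord z (0, 1))" if "0 \<le> r" for r
  proof -
    have "- (r *\<^sub>R coord_01) \<in> normal_cone C_half w"
    proof -
      have "0 \<le> r * (1 + coord y (0, 1))" if "- 1 \<le> coord y (0, 1)" for y
        using that \<open>0 \<le> r\<close> by (intro mult_nonneg_nonneg) auto
      then show ?thesis
        using w by (fastforce simp: normal_cone_def C_half_def blinfun.minus_left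
            blinfun.scaleR_left algebra_simps)
    qed
    then have "0 \<le> blinfun_apply (p - - (r *\<^sub>R coord_01)) (z - w)"
      using bspec[OF rel, of "(w, - (r *\<^sub>R coord_01))"] by (simp add: gra_def)
    then show ?thesis
      using w by (simp add: blinfun.add_left blinfun.scaleR_left algebra_simps)
  qed
  note bound = this
  have z: "z \<in> C_half"
  proof (rule ccontr)
    assume "z \<notin> C_half"
    then have neg: "0 < - 1 - coord z (0, 1)" by (simp add: C_half_def)
    define r where "r = (\<bar>blinfun_apply p (z - w)\<bar> + 1) / (- 1 - coord z (0, 1))"
    have "0 \<le> r" using neg by (simp add: r_def)
    from bound[OF this] show False using neg by (simp add: r_def)
  qed
  have "blinfun_apply p (y - z) \<le> 0" if "y \<in> C_half" for y
  proof -
    have "0 \<in> normal_cone C_half y" using that by (simp add: normal_cone_def)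
    then have "0 \<le> blinfun_apply (p - 0) (z - y)" using bspec[OF rel, of "(y, 0)"] by (simp add: gra_def)
    then show ?thesis by (simp add: blinfun.diff_right)
  qed
  then show "(z, p) \<in> gra (normal_cone C_half)"
    using z by (simp add: gra_def normal_cone_def)
qed

lemma op_dom_normal_cone: "op_dom (normal_cone C) = C"
proof (rule set_eqI)
  fix x
  have "0 \<in> normal_cone C x \<longleftrightarrow> x \<in> C" by (simp add: normal_cone_def)
  moreover have "normal_cone C x = {}" if "x \<notin> C" using that by (simp add: normal_cone_def)
  ultimately show "x \<in> op_dom (normal_cone C) \<longleftrightarrow> x \<in> C" unfolding op_dom_def by blast
qed

lemma interior_C_halfI:
  assumes "- 1 < coord x (0, 1)"
  shows "x \<in> interior C_half"
proof (rule interiorI)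
  have "open ((\<lambda>x. coord x (0, 1)) -` {- 1<..})"
    by (intro open_vimage open_greaterThan linear_continuous_on bounded_linear_coord)
  then show "open {x. - 1 < coord x (0, 1)}" by (simp add: vimage_def)
qed (use assms in \<open>auto simp: C_half_def\<close>)

lemma normal_cone_interior:
  assumes x: "x \<in> interior C" and p: "p \<in> normal_cone C x"
  shows "p = 0"
proof (rule blinfun_eqI)
  fix v
  have le: "blinfun_apply p v \<le> 0" for v
  proof -
    have "((\<lambda>r. x + r *\<^sub>R v) \<longlongrightarrow> x + 0 *\<^sub>R v) (at_right 0)" by (intro tendsto_intros)
    then have "\<forall>\<^sub>F r in at_right 0. x + r *\<^sub>R v \<in> interior C"
      using x by (intro topological_tendstoD) auto
    then have "\<forall>\<^sub>F r in at_right (0::real). x + r *\<^sub>R v \<in> interior C \<and> 0 < r"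
      by (intro eventually_conj eventually_at_right_less)
    then obtain r where r: "x + r *\<^sub>R v \<in> C" "0 < r"
      using eventually_happens'[of "at_right (0::real)"] interior_subset by fastforce
    have "blinfun_apply p ((x + r *\<^sub>R v) - x) \<le> 0"
      using p r(1) by (auto simp: normal_cone_def split: if_splits)
    then show ?thesis using r(2) by (simp add: blinfun.scaleR_right mult_le_0_iff)
  qed
  show "blinfun_apply p v = blinfun_apply 0 v"
    using le[of v] le[of "- v"] by (simp add: blinfun.minus_right)
qed

section \<open>Failure of the sum theorem\<close>

text \<open>
  The half-space removes the branch \<open>x (0, 1) < - 1\<close>, and on the other branch the normal cone is
  trivial. Nothing obstructs an extension at \<open>0\<close> any more: against the pair of \<open>0\<close> and minus the
  distinguished coordinate, a graph point with coordinate \<open>t > 1\<close> gives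
  \<open>t + t (t - 1) - \<Sum>b\<ge>1. (t\<^sup>2 4) ^ - b\<close>, which is at least \<open>t\<^sup>2 - 1\<close>.
\<close>

lemma not_maximally_monotone_sum:
  "\<not> maximally_monotone (op_sum A_op (normal_cone C_half))"
proof
  assume "maximally_monotone (op_sum A_op (normal_cone C_half))"
  then have max: "(0, - coord_01) \<in> gra (op_sum A_op (normal_cone C_half))"
    if "\<And>x a. (x, a) \<in> gra (op_sum A_op (normal_cone C_half)) \<Longrightarrow>
      0 \<le> blinfun_apply (- coord_01 - a) (0 - x)"
    using that unfolding maximally_monotone_def by blast
  have "(0, - coord_01) \<in> gra (op_sum A_op (normal_cone C_half))"
  proof (rule max)
    fix x \<alpha> assume "(x, \<alpha>) \<in> gra (op_sum A_op (normal_cone C_half))"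
    then obtain a n where g: "A_graph x a" and n: "n \<in> normal_cone C_half x"
      and \<alpha>: "\<alpha> = l1_functional a + n"
      by (auto simp: gra_def op_sum_def A_op_iff)
    define t where "t = coord x (0, 1)"
    have "x \<in> C_half" using n by (auto simp: normal_cone_def split: if_splits)
    then have t: "1 < t" using g by (auto simp: A_graph_def C_half_def t_def)
    then have "x \<in> interior C_half" by (intro interior_C_halfI) (simp add: t_def)
    then have "n = 0" using n by (rule normal_cone_interior)
    have "(suminf (block a (Suc b)))\<^sup>2 / 4 ^ Suc b \<le> (real (Suc b))\<^sup>2 / 4 ^ Suc b * 1" for b
    proof -
      have "1 / t ^ Suc b \<le> 1" using t by (simp add: one_le_power del: power_Suc)
      then have "1 / t ^ Suc b \<le> real (Suc b)" by simp
      then have "(1 / t ^ Suc b)\<^sup>2 \<le> (real (Suc b))\<^sup>2"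
        by (rule power_mono) (use t in simp)
      moreover have "suminf (block a (Suc b)) = 1 / t ^ Suc b"
        using g t by (simp add: A_graph_def t_def)
      ultimately show ?thesis by (simp add: divide_right_mono del: power_Suc)
    qed
    then have "coord x (0, 1) * a (0, 1) - 1 \<le> blinfun_apply (l1_functional a) x"
      using g by (intro diff_le_by_square_weights[OF pairing_linked]) (auto simp: A_graph_def)
    moreover have "a (0, 1) = t - 1" using g t by (simp add: A_graph_def t_def)
    ultimately have "t * (t - 1) - 1 \<le> blinfun_apply (l1_functional a) x" by (simp add: t_def)
    moreover have "1 \<le> t * t" using t mult_mono[of 1 t 1 t] by simp
    ultimately show "0 \<le> blinfun_apply (- coord_01 - \<alpha>) (0 - x)"
      using \<open>n = 0\<close> \<alpha> by (simp add: blinfun.diff_left blinfun.minus_left blinfun.minus_right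
          t_def algebra_simps)
  qed
  then show False by (auto simp: gra_def op_sum_def A_op_iff A_graph_def)
qed

text \<open>
  Summation of the coefficients is a bounded functional on the dual. Evaluated at the coordinate
  functionals it is \<open>1\<close>, so a representing point would be the constant array \<open>1\<close>, which is not null.
\<close>

lemma not_reflexive_c0: "\<not> reflexive_space TYPE(c0)"
proof
  assume refl: "reflexive_space TYPE(c0)"
  \<comment> \<open>This is the array of all ones, as an element of the bidual.\<close>
  define \<sigma> where "\<sigma> p = (\<Sum>\<^sub>\<infinity>i\<in>idx. blinfun_apply p (unit_array i))" for p :: "c0 \<Rightarrow>\<^sub>L real"
  have abs: "(\<lambda>i. norm (blinfun_apply p (unit_array i))) summable_on idx" for p :: "c0 \<Rightarrow>\<^sub>L real"
    by (rule nonneg_bdd_above_summable_on)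
      (auto intro!: bdd_aboveI[where M = "norm p"] simp: functional_coeffs_bound)
  note summ = abs_summable_summable[OF abs]
  have "bounded_linear \<sigma>"
  proof (rule bounded_linear_intro[where K = 1])
    fix p q :: "c0 \<Rightarrow>\<^sub>L real" and r :: real
    show "\<sigma> (p + q) = \<sigma> p + \<sigma> q"
      by (simp add: \<sigma>_def blinfun.add_left infsum_add[OF summ summ])
    show "\<sigma> (r *\<^sub>R p) = r *\<^sub>R \<sigma> p"
      by (simp add: \<sigma>_def blinfun.scaleR_left infsum_cmult_right')
    have "norm (\<sigma> p) \<le> (\<Sum>\<^sub>\<infinity>i\<in>idx. norm (blinfun_apply p (unit_array i)))"
      unfolding \<sigma>_def by (rule norm_infsum_bound[OF abs])
    also have "\<dots> \<le> norm p"
      by (rule infsum_le_finite_sums[OF abs]) (simp add: functional_coeffs_bound)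
    finally show "norm (\<sigma> p) \<le> norm p * 1" by simp
  qed
  then have apply_\<sigma>: "blinfun_apply (Blinfun \<sigma>) p = \<sigma> p" for p
    by (simp add: bounded_linear_Blinfun_apply)
  obtain x where x: "Blinfun \<sigma> = bidual_embedding x"
    using refl unfolding reflexive_space_def by (metis surjD)
  have "coord x k = 1" if k: "k \<in> idx" for k
  proof -
    define p where "p = Blinfun (\<lambda>x. coord x k)"
    have p: "blinfun_apply p y = coord y k" for y
      by (simp add: p_def bounded_linear_Blinfun_apply[OF bounded_linear_coord])
    have "coord x k = \<sigma> p"
      using apply_\<sigma>[of p] by (simp add: x bidual_embedding_apply p)
    also have "\<dots> = (\<Sum>\<^sub>\<infinity>i\<in>{k}. 1)"
      unfolding \<sigma>_def
      by (rule infsum_cong_neutral) (use k in \<open>auto simp: p coord_unit_array\<close>)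
    finally show ?thesis by simp
  qed
  then have "{i\<in>idx. 1 \<le> \<bar>coord x i\<bar>} = idx" by auto
  then have "finite idx" using coord_finite[of 1 x] by simp
  then show False by (simp add: idx_def finite_cartesian_product_iff infinite_Ici)
qed

theorem corollary5:
  shows "maximally_monotone A_op
    \<and> maximally_monotone (normal_cone C_half)
    \<and> op_dom A_op \<inter> interior (op_dom (normal_cone C_half)) \<noteq> {}
    \<and> \<not> maximally_monotone (op_sum A_op (normal_cone C_half))
    \<and> \<not> reflexive_space TYPE(c0)
    \<and> (\<exists>A B :: c0 setop.
          maximally_monotone A \<and> maximally_monotone B
          \<and> op_dom A \<inter> interior (op_dom B) \<noteq> {}
          \<and> \<not> maximally_monotone (op_sum A B))"
proof -
  obtain x a where "A_graph x a" "coord x (0, 1) = 2" by (rule A_graph_exists[of 2]) auto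
  then have "x \<in> D" "x \<in> interior C_half" by (auto intro: A_graph_imp_D interior_C_halfI)
  then have "op_dom A_op \<inter> interior (op_dom (normal_cone C_half)) \<noteq> {}"
    unfolding op_dom_A_op op_dom_normal_cone by blast
  then show ?thesis
    using maximally_monotone_A_op maximally_monotone_normal_cone_C_half
      not_maximally_monotone_sum not_reflexive_c0 by blast
qed

end
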